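(* Let $G$ be a (discrete, finitely generated) hyperbolic group with asymptotic dimension $\operatorname{asdim}G\le 2$. Then every finitely presented subgroup of $G$ is hyperbolic.
   Context: $\operatorname{asdim}G$ denotes the asymptotic dimension of $G$ with a word metric with respect to a finite generating set (a quasi-isometry invariant). *)

theory Defs
  imports "HOL-Algebra.Group" "HOL-Algebra.Generated_Groups" Complex_Main
begin

definition fin_gen_set :: "('a, 'b) monoid_scheme \<Rightarrow> 'a set \<Rightarrow> bool" where
  "fin_gen_set G S \<longleftrightarrow> finite S \<and> S \<subseteq> carrier G \<and> generate G S = carrier G"

definition finitely_generated_group :: "('a, 'b) monoid_scheme \<Rightarrow> bool" where
  "finitely_generated_group G \<longleftrightarrow> group G \<and> (\<exists>S. fin_gen_set G S)"

definition list_prod :: "('a, 'b) monoid_scheme \<Rightarrow> 'a list \<Rightarrow> 'a" where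
  "list_prod G xs = foldr (\<lambda>x acc. x \<otimes>\<^bsub>G\<^esub> acc) xs \<one>\<^bsub>G\<^esub>"

definition word_length :: "('a, 'b) monoid_scheme \<Rightarrow> 'a set \<Rightarrow> 'a \<Rightarrow> nat" where
  "word_length G S g =
     (LEAST n. \<exists>xs. xs \<in> lists (S \<union> (\<lambda>s. inv\<^bsub>G\<^esub> s) ` S) \<and> length xs = n \<and> list_prod G xs = g)"

definition word_dist :: "('a, 'b) monoid_scheme \<Rightarrow> 'a set \<Rightarrow> 'a \<Rightarrow> 'a \<Rightarrow> real" where
  "word_dist G S x y = real (word_length G S (inv\<^bsub>G\<^esub> x \<otimes>\<^bsub>G\<^esub> y))"

definition gromov_product :: "('p \<Rightarrow> 'p \<Rightarrow> real) \<Rightarrow> 'p \<Rightarrow> 'p \<Rightarrow> 'p \<Rightarrow> real" where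
  "gromov_product d w x y = (d x w + d y w - d x y) / 2"

definition gromov_hyperbolic_on :: "'p set \<Rightarrow> ('p \<Rightarrow> 'p \<Rightarrow> real) \<Rightarrow> bool" where
  "gromov_hyperbolic_on X d \<longleftrightarrow> (\<exists>\<delta>\<ge>0. \<forall>x\<in>X. \<forall>y\<in>X. \<forall>z\<in>X. \<forall>w\<in>X.
      gromov_product d w x z \<ge> min (gromov_product d w x y) (gromov_product d w y z) - \<delta>)"

definition hyperbolic_group :: "('a, 'b) monoid_scheme \<Rightarrow> bool" where
  "hyperbolic_group G \<longleftrightarrow> group G \<and>
     (\<exists>S. fin_gen_set G S \<and> gromov_hyperbolic_on (carrier G) (word_dist G S))"

definition asdim_le_on :: "'p set \<Rightarrow> ('p \<Rightarrow> 'p \<Rightarrow> real) \<Rightarrow> nat \<Rightarrow> bool" where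
  "asdim_le_on X d n \<longleftrightarrow> (\<forall>r>0. \<exists>(U :: nat \<Rightarrow> 'p set set) D.
      (\<Union>i\<le>n. \<Union>(U i)) = X \<and>
      (\<forall>i\<le>n. \<forall>A\<in>U i. \<forall>x\<in>A. \<forall>y\<in>A. d x y \<le> D) \<and>
      (\<forall>i\<le>n. \<forall>A\<in>U i. \<forall>B\<in>U i. A \<noteq> B \<longrightarrow> (\<forall>x\<in>A. \<forall>y\<in>B. d x y > r)))"

definition asdim_group_le :: "('a, 'b) monoid_scheme \<Rightarrow> nat \<Rightarrow> bool" where
  "asdim_group_le G n \<longleftrightarrow> (\<exists>S. fin_gen_set G S \<and> asdim_le_on (carrier G) (word_dist G S) n)"

text \<open>Words over generators indexed by naturals; a letter (i, True) stands for the inverse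
  of generator i.\<close>
type_synonym word = "(nat \<times> bool) list"

definition word_eval :: "('a, 'b) monoid_scheme \<Rightarrow> (nat \<Rightarrow> 'a) \<Rightarrow> word \<Rightarrow> 'a" where
  "word_eval G f w = list_prod G (map (\<lambda>(i, b). if b then inv\<^bsub>G\<^esub> (f i) else f i) w)"

inductive pres_eq :: "word set \<Rightarrow> word \<Rightarrow> word \<Rightarrow> bool" for R where
  pe_refl: "pres_eq R u u"
| pe_sym: "pres_eq R u v \<Longrightarrow> pres_eq R v u"
| pe_trans: "pres_eq R u v \<Longrightarrow> pres_eq R v w \<Longrightarrow> pres_eq R u w"
| pe_cancel: "pres_eq R (u @ [(i, b), (i, \<not> b)] @ v) (u @ v)"
| pe_rel: "r \<in> R \<Longrightarrow> pres_eq R (u @ r @ v) (u @ v)"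

definition finitely_presented :: "('a, 'b) monoid_scheme \<Rightarrow> bool" where
  "finitely_presented G \<longleftrightarrow> group G \<and> (\<exists>(n::nat) (f::nat \<Rightarrow> 'a) (R::word set).
      f ` {..<n} \<subseteq> carrier G \<and> generate G (f ` {..<n}) = carrier G \<and>
      finite R \<and> R \<subseteq> lists ({..<n} \<times> UNIV) \<and>
      (\<forall>w \<in> lists ({..<n} \<times> UNIV). word_eval G f w = \<one>\<^bsub>G\<^esub> \<longleftrightarrow> pres_eq R w []))"

end

theory Submission
  imports Defs "HOL-Library.Z2"
begin

text \<open>
  All cochains have coefficients in the field with two elements. Asymptotic dimension at most two
  yields, at every scale \<open>r\<close>, a map \<open>\<pi>\<close> from \<open>G\<close> to a set of uniformly bounded pieces which
  identifies two of any four points that are pairwise at distance at most \<open>r\<close>. Hence the pullback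
  under \<open>\<pi>\<close> of an arbitrary \<open>2\<close>-cochain is a cocycle on the Rips complex of \<open>G\<close> at scale \<open>r\<close>, and
  it has a primitive \<open>\<theta>\<close> there because \<open>G\<close> is hyperbolic.

  Suppose a loop in the Cayley graph of \<open>H\<close> consists of a geodesic \<open>\<alpha>\<close> and a path of length \<open>O(R)\<close>
  that stays \<open>R / 2\<close> away from a point of \<open>\<alpha>\<close>. In coordinates (distance from the start of \<open>\<alpha>\<close>,
  distance from \<open>\<alpha>\<close>) it winds around each of about \<open>R\<^sup>2\<close> lattice points \<open>(s, t)\<close>. A \<open>1\<close>-cochain
  detecting the winding around \<open>(s, t)\<close> has a coboundary which, moved to the pieces that meet \<open>H\<close>
  and pulled back to \<open>G\<close>, has a primitive \<open>\<theta>\<close>. On \<open>H\<close> the two \<open>1\<close>-cochains differ by a cocycle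
  without periods, as \<open>H\<close> is finitely presented, so \<open>\<theta>\<close> is nonzero on the loop for each \<open>(s, t)\<close>.
  But in \<open>G\<close> the loop is filled by \<open>O(R log R)\<close> small triangles, each of which meets a bounded number
  of points \<open>(s, t)\<close>. So \<open>R\<close> is bounded, and the absence of such fat loops makes triangles in \<open>H\<close>
  slim.
\<close>

section \<open>Fat loops and slim triangles\<close>

lemma image_rev_atMost: "(\<lambda>i. f (n - i)) ` {..n} = f ` {..n::nat}"
proof
  show "f ` {..n} \<subseteq> (\<lambda>i. f (n - i)) ` {..n}"
  proof
    fix y assume "y \<in> f ` {..n}"
    then obtain i where "i \<le> n" "y = f i" by auto
    then show "y \<in> (\<lambda>i. f (n - i)) ` {..n}" by (intro image_eqI[of _ _ "n - i"]) auto
  qed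
qed auto

section \<open>Integer-valued graph metrics, geodesics and paths that avoid a set\<close>

locale graph_metric =
  fixes X :: "'a set" and d :: "'a \<Rightarrow> 'a \<Rightarrow> nat"
  assumes d_self [simp]: "x \<in> X \<Longrightarrow> d x x = 0"
    and d_eq_0: "x \<in> X \<Longrightarrow> y \<in> X \<Longrightarrow> d x y = 0 \<Longrightarrow> x = y"
    and d_sym: "x \<in> X \<Longrightarrow> y \<in> X \<Longrightarrow> d x y = d y x"
    and d_tri: "x \<in> X \<Longrightarrow> y \<in> X \<Longrightarrow> z \<in> X \<Longrightarrow> d x z \<le> d x y + d y z"
    and d_step: "x \<in> X \<Longrightarrow> y \<in> X \<Longrightarrow> x \<noteq> y \<Longrightarrow> \<exists>z\<in>X. d x z \<le> 1 \<and> d z y < d x y"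
begin

definition geodesic :: "(nat \<Rightarrow> 'a) \<Rightarrow> nat \<Rightarrow> bool" where
  "geodesic \<gamma> n \<longleftrightarrow> (\<forall>i\<le>n. \<gamma> i \<in> X) \<and> (\<forall>i j. i \<le> j \<longrightarrow> j \<le> n \<longrightarrow> d (\<gamma> i) (\<gamma> j) = j - i)"

lemma geodesic_in: "geodesic \<gamma> n \<Longrightarrow> i \<le> n \<Longrightarrow> \<gamma> i \<in> X"
  by (simp add: geodesic_def)

lemma geodesic_dist: "geodesic \<gamma> n \<Longrightarrow> i \<le> j \<Longrightarrow> j \<le> n \<Longrightarrow> d (\<gamma> i) (\<gamma> j) = j - i"
  by (simp add: geodesic_def)

lemma geodesic_dist': "geodesic \<gamma> n \<Longrightarrow> i \<le> j \<Longrightarrow> j \<le> n \<Longrightarrow> d (\<gamma> j) (\<gamma> i) = j - i"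
  using d_sym[of "\<gamma> j" "\<gamma> i"] by (simp add: geodesic_def)

lemma geodesic_shift:
  assumes "geodesic \<gamma> n" "a \<le> b" "b \<le> n"
  shows "geodesic (\<lambda>i. \<gamma> (a + i)) (b - a)"
  using assms by (auto simp: geodesic_def)

lemma geodesic_rev:
  assumes "geodesic \<gamma> n"
  shows "geodesic (\<lambda>i. \<gamma> (n - i)) n"
  unfolding geodesic_def
proof (intro conjI allI impI)
  fix i j :: nat assume ij: "i \<le> j" "j \<le> n"
  then show "d (\<gamma> (n - i)) (\<gamma> (n - j)) = j - i"
    using geodesic_dist'[OF assms, of "n - j" "n - i"] by simp
qed (use assms in \<open>simp add: geodesic_def\<close>)

text \<open>\<open>d_step\<close> supplies a vertex next to \<open>x\<close> and closer to
  \<open>y\<close>. By the triangle inequality the step and the gain are both exactly one, so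
  prepending \<open>x\<close> to a geodesic from that vertex gives a geodesic.\<close>

lemma geodesic_exists:
  assumes "x \<in> X" "y \<in> X"
  shows "\<exists>\<gamma>. geodesic \<gamma> (d x y) \<and> \<gamma> 0 = x \<and> \<gamma> (d x y) = y"
  using assms
proof (induction "d x y" arbitrary: x)
  case 0
  then have "x = y" using d_eq_0 by metis
  then show ?case using 0 by (intro exI[of _ "\<lambda>_. x"]) (simp add: geodesic_def)
next
  case (Suc n)
  then have "x \<noteq> y" by auto
  then obtain z where z: "z \<in> X" "d x z \<le> 1" "d z y < d x y" using d_step Suc.prems by blast
  moreover have "d x y \<le> d x z + d z y" using d_tri Suc.prems z by blast
  ultimately have dn: "d z y = n" "d x z = 1" using Suc.hyps(2) by linarith+
  obtain \<gamma> where \<gamma>: "geodesic \<gamma> n" "\<gamma> 0 = z" "\<gamma> n = y"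
    using Suc.hyps(1)[of z] dn z Suc.prems by auto
  define \<gamma>' where "\<gamma>' i = (case i of 0 \<Rightarrow> x | Suc j \<Rightarrow> \<gamma> j)" for i
  have far: "d x (\<gamma> j) = Suc j" if "j \<le> n" for j
  proof -
    have "d x (\<gamma> j) \<le> d x z + d z (\<gamma> j)" using d_tri Suc.prems z geodesic_in[OF \<gamma>(1) that] by blast
    moreover have "d z (\<gamma> j) = j" using geodesic_dist[OF \<gamma>(1), of 0 j] that \<gamma> by simp
    moreover have "d x y \<le> d x (\<gamma> j) + d (\<gamma> j) y"
      using d_tri Suc.prems geodesic_in[OF \<gamma>(1) that] by blast
    moreover have "d (\<gamma> j) y = n - j" using geodesic_dist[OF \<gamma>(1), of j n] that \<gamma> by simp
    ultimately show ?thesis using dn Suc.hyps(2) that by linarith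
  qed
  have "geodesic \<gamma>' (Suc n)"
    unfolding geodesic_def
  proof (intro conjI allI impI)
    fix i assume "i \<le> Suc n"
    then show "\<gamma>' i \<in> X"
      using Suc.prems geodesic_in[OF \<gamma>(1)] by (auto simp: \<gamma>'_def split: nat.split)
  next
    fix i j assume "i \<le> j" "j \<le> Suc n"
    then show "d (\<gamma>' i) (\<gamma>' j) = j - i"
      using Suc.prems far geodesic_dist[OF \<gamma>(1)] by (auto simp: \<gamma>'_def split: nat.split)
  qed
  then show ?case using Suc.hyps(2) \<gamma> by (intro exI[of _ \<gamma>']) (metis \<gamma>'_def nat.case)
qed

text \<open>Steps of length zero are allowed, so a path may pause; \<open>k\<close> is only an upper
  bound for its length.\<close>

definition joined :: "('a \<Rightarrow> bool) \<Rightarrow> nat \<Rightarrow> 'a \<Rightarrow> 'a \<Rightarrow> bool" where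
  "joined P k x y \<longleftrightarrow> (\<exists>\<eta> m. m \<le> k \<and> \<eta> 0 = x \<and> \<eta> m = y \<and>
     (\<forall>i\<le>m. \<eta> i \<in> X \<and> P (\<eta> i)) \<and> (\<forall>i<m. d (\<eta> i) (\<eta> (Suc i)) \<le> 1))"

lemma joined_mono:
  assumes "joined P k x y" "k \<le> l" shows "joined P l x y"
proof -
  obtain \<eta> m where "m \<le> k" "\<eta> 0 = x" "\<eta> m = y" "\<forall>i\<le>m. \<eta> i \<in> X \<and> P (\<eta> i)"
    "\<forall>i<m. d (\<eta> i) (\<eta> (Suc i)) \<le> 1"
    using assms unfolding joined_def by blast
  then show ?thesis using assms(2) unfolding joined_def by (intro exI[of _ \<eta>] exI[of _ m]) auto
qed

lemma joined_sym:
  assumes "joined P k x y" shows "joined P k y x"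
proof -
  obtain \<eta> m where \<eta>: "m \<le> k" "\<eta> 0 = x" "\<eta> m = y" "\<forall>i\<le>m. \<eta> i \<in> X \<and> P (\<eta> i)"
    "\<forall>i<m. d (\<eta> i) (\<eta> (Suc i)) \<le> 1"
    using assms unfolding joined_def by blast
  have "d (\<eta> (m - i)) (\<eta> (m - Suc i)) \<le> 1" if "i < m" for i
  proof -
    have "d (\<eta> (m - Suc i)) (\<eta> (Suc (m - Suc i))) \<le> 1" using \<eta>(5) that by simp
    moreover have "Suc (m - Suc i) = m - i" using that by simp
    moreover have "\<eta> (m - Suc i) \<in> X" "\<eta> (m - i) \<in> X" using \<eta>(4) by auto
    ultimately show ?thesis using d_sym by metis
  qed
  then show ?thesis unfolding joined_def using \<eta>
    by (intro exI[of _ "\<lambda>i. \<eta> (m - i)"] exI[of _ m]) auto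
qed

lemma joined_trans:
  assumes "joined P k x y" "joined P l y z" shows "joined P (k + l) x z"
proof -
  obtain \<eta> m where \<eta>: "m \<le> k" "\<eta> 0 = x" "\<eta> m = y" "\<forall>i\<le>m. \<eta> i \<in> X \<and> P (\<eta> i)"
    "\<forall>i<m. d (\<eta> i) (\<eta> (Suc i)) \<le> 1"
    using assms unfolding joined_def by blast
  obtain \<zeta> n where \<zeta>: "n \<le> l" "\<zeta> 0 = y" "\<zeta> n = z" "\<forall>i\<le>n. \<zeta> i \<in> X \<and> P (\<zeta> i)"
    "\<forall>i<n. d (\<zeta> i) (\<zeta> (Suc i)) \<le> 1"
    using assms unfolding joined_def by blast
  define \<xi> where "\<xi> i = (if i \<le> m then \<eta> i else \<zeta> (i - m))" for i
  have \<xi>m: "\<xi> (m + i) = \<zeta> i" for i using \<eta> \<zeta> by (auto simp: \<xi>_def)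
  have "\<xi> i \<in> X \<and> P (\<xi> i)" if "i \<le> m + n" for i using that \<eta>(4) \<zeta>(4) by (auto simp: \<xi>_def)
  moreover have "d (\<xi> i) (\<xi> (Suc i)) \<le> 1" if "i < m + n" for i
  proof (cases "i < m")
    case True then show ?thesis using \<eta>(5) by (auto simp: \<xi>_def)
  next
    case False
    then obtain j where j: "i = m + j" using le_iff_add not_less by blast
    then show ?thesis using \<xi>m[of j] \<xi>m[of "Suc j"] \<zeta>(5) that by auto
  qed
  moreover have "\<xi> 0 = x" using \<eta> by (simp add: \<xi>_def)
  moreover have "\<xi> (m + n) = z" using \<xi>m \<zeta> by simp
  moreover have "m + n \<le> k + l" using \<eta> \<zeta> by simp
  ultimately show ?thesis unfolding joined_def by (intro exI[of _ \<xi>] exI[of _ "m + n"]) auto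
qed

lemma joined_geodesic:
  assumes "geodesic \<gamma> n" "i \<le> n" "j \<le> n" "\<And>k. k \<le> n \<Longrightarrow> P (\<gamma> k)"
  shows "joined P (d (\<gamma> i) (\<gamma> j)) (\<gamma> i) (\<gamma> j)"
proof -
  have *: "joined P (d (\<gamma> i) (\<gamma> j)) (\<gamma> i) (\<gamma> j)" if "i \<le> j" "j \<le> n" for i j
    unfolding joined_def
    using that assms(1,4) by (intro exI[of _ "\<lambda>k. \<gamma> (i + k)"] exI[of _ "j - i"])
      (auto simp: geodesic_def)
  show ?thesis
  proof (cases "i \<le> j")
    case False
    then show ?thesis using joined_sym[OF *[of j i]] assms d_sym geodesic_in by simp
  qed (use * assms in blast)
qed

text \<open>At every scale beyond \<open>R0\<close>, a path of length O(R) between the ends of a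
  geodesic of length O(R) comes closer than R/2 to each point of the geodesic. The factor 100 leaves
  room for all detours in \<open>fat_side_bound\<close>; the distance is doubled in order to stay in
  the naturals.\<close>

definition no_fat_loops :: "nat \<Rightarrow> bool" where
  "no_fat_loops R0 \<longleftrightarrow> (\<forall>R>R0. \<forall>\<alpha> n s. geodesic \<alpha> n \<longrightarrow> s \<le> n \<longrightarrow> n \<le> 100 * R \<longrightarrow>
     \<not> joined (\<lambda>q. R \<le> 2 * d q (\<alpha> s)) (100 * R) (\<alpha> 0) (\<alpha> n))"

lemma joined_short:
  assumes "x \<in> X" "y \<in> X" "d x y \<le> k" "\<And>q. q \<in> X \<Longrightarrow> d x q + d q y = d x y \<Longrightarrow> P q"
  shows "joined P k x y"
proof -
  obtain \<gamma> where \<gamma>: "geodesic \<gamma> (d x y)" "\<gamma> 0 = x" "\<gamma> (d x y) = y"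
    using geodesic_exists assms by blast
  have "P (\<gamma> i)" if "i \<le> d x y" for i
    using assms(4)[OF geodesic_in[OF \<gamma>(1) that]] geodesic_dist[OF \<gamma>(1), of 0 i]
      geodesic_dist[OF \<gamma>(1), of i "d x y"] \<gamma> that by simp
  then have "joined P (d x y) x y" using joined_geodesic[OF \<gamma>(1), of 0 "d x y" P] \<gamma> by simp
  then show ?thesis using assms(3) joined_mono by blast
qed

text \<open>Starting from the fattest point \<open>p\<close> of the triangle, a detour around the ball of radius
  \<open>R / 2\<close> at \<open>p\<close> leaves the side at distance \<open>2 * R\<close> before \<open>p\<close>, descends to the other two
  sides and returns behind \<open>p\<close>. Maximality of \<open>R\<close> keeps its length linear in \<open>R\<close>.\<close>
lemma fat_side_bound:
  assumes nf: "no_fat_loops R0"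
    and \<alpha>: "geodesic \<alpha> n" and \<beta>: "geodesic \<beta> m" and \<gamma>: "geodesic \<gamma> l"
    and ends: "\<beta> 0 = \<alpha> 0" "\<beta> m = \<gamma> 0" "\<gamma> l = \<alpha> n"
    and slim\<alpha>: "\<And>i. i \<le> n \<Longrightarrow> \<exists>q\<in>\<beta> ` {..m} \<union> \<gamma> ` {..l}. d (\<alpha> i) q \<le> R"
    and slim\<beta>: "\<And>i. i \<le> m \<Longrightarrow> \<exists>q\<in>\<alpha> ` {..n} \<union> \<gamma> ` {..l}. d (\<beta> i) q \<le> R"
    and slim\<gamma>: "\<And>i. i \<le> l \<Longrightarrow> \<exists>q\<in>\<alpha> ` {..n} \<union> \<beta> ` {..m}. d (\<gamma> i) q \<le> R"
    and s: "s \<le> n" and fat: "\<And>q. q \<in> \<beta> ` {..m} \<union> \<gamma> ` {..l} \<Longrightarrow> R \<le> d (\<alpha> s) q"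
  shows "R \<le> R0"
proof (rule ccontr)
  assume "\<not> R \<le> R0"
  then have R: "R0 < R" by simp
  define p where "p = \<alpha> s"
  define P where "P = (\<lambda>q. R \<le> 2 * d q p)"
  define B where "B = \<beta> ` {..m}"
  define C where "C = \<gamma> ` {..l}"
  have \<alpha>X: "\<alpha> i \<in> X" if "i \<le> n" for i using geodesic_in[OF \<alpha> that] .
  have BX: "q \<in> X" if "q \<in> B" for q using that geodesic_in[OF \<beta>] by (auto simp: B_def)
  have CX: "q \<in> X" if "q \<in> C" for q using that geodesic_in[OF \<gamma>] by (auto simp: C_def)
  have BCX: "q \<in> X" if "q \<in> B \<union> C" for q using that BX CX by blast
  have pX: "p \<in> X" using \<alpha>X s by (simp add: p_def)
  have far: "R \<le> d q p" if "q \<in> B \<union> C" for q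
    using fat that d_sym[of q p] BX CX pX unfolding B_def C_def p_def by auto
  have BP: "P q" if "q \<in> B \<union> C" for q using far[OF that] by (simp add: P_def)
  have jB: "joined P (d q q') q q'" if q: "q \<in> B" "q' \<in> B" for q q'
  proof -
    obtain i j where ij: "i \<le> m" "j \<le> m" "q = \<beta> i" "q' = \<beta> j" using q by (auto simp: B_def)
    show ?thesis using joined_geodesic[OF \<beta> ij(1,2), of P] BP ij by (auto simp: B_def)
  qed
  have jC: "joined P (d q q') q q'" if q: "q \<in> C" "q' \<in> C" for q q'
  proof -
    obtain i j where ij: "i \<le> l" "j \<le> l" "q = \<gamma> i" "q' = \<gamma> j" using q by (auto simp: C_def)
    show ?thesis using joined_geodesic[OF \<gamma> ij(1,2), of P] BP ij by (auto simp: C_def)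
  qed
  have near_end: "joined P R x y" if "x \<in> X" "y \<in> X" "d x y \<le> R" "2 * R \<le> d x p" for x y
  proof (rule joined_short[OF that(1-3)])
    fix q assume "q \<in> X" "d x q + d q y = d x y"
    moreover have "d x p \<le> d x q + d q p" using d_tri \<open>q \<in> X\<close> pX that by blast
    ultimately show "P q" using that by (simp add: P_def)
  qed
  \<comment> \<open>A point of a path of length at most \<open>R\<close> is within \<open>R / 2\<close> of one of its ends.\<close>
  have bridge: "joined P R x y" if "x \<in> B \<union> C" "y \<in> B \<union> C" "d x y \<le> R" for x y
  proof (rule joined_short[OF _ _ that(3)])
    show XY: "x \<in> X" "y \<in> X" using that BX CX by auto
    fix q assume q: "q \<in> X" "d x q + d q y = d x y"
    have "d x p \<le> d x q + d q p" "d y p \<le> d y q + d q p" using d_tri q pX XY by blast+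
    moreover have "d y q = d q y" using d_sym q XY by blast
    ultimately show "P q" using that far[OF that(1)] far[OF that(2)] q by (simp add: P_def)
  qed
  \<comment> \<open>Truncation matters: if an end of \<open>\<alpha>\<close> is less than
    \<open>2 * R\<close> away from \<open>p\<close>, that end is used instead. It is a corner of the
    triangle, so it already lies on another side and the descent is trivial.\<close>
  define a where "a = s - 2 * R"
  define b where "b = min (s + 2 * R) n"
  have ab: "a \<le> s" "s \<le> b" "b \<le> n" "a \<le> n" "b - a \<le> 4 * R" using s by (auto simp: a_def b_def)
  have "\<exists>u\<in>B \<union> C. d (\<alpha> a) u \<le> R \<and> joined P R (\<alpha> a) u"
  proof (cases "s \<ge> 2 * R")
    case True
    obtain u where "u \<in> B \<union> C" "d (\<alpha> a) u \<le> R" using slim\<alpha>[of a] ab by (auto simp: B_def C_def)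
    moreover have "d (\<alpha> a) p = 2 * R"
      using geodesic_dist[OF \<alpha>, of a s] ab s True by (simp add: p_def a_def)
    ultimately show ?thesis using near_end[of "\<alpha> a" u] \<alpha>X[of a] ab BCX[of u] by auto
  next
    case False
    then have "\<alpha> a = \<beta> 0" using ends by (simp add: a_def)
    then have "\<alpha> a \<in> B \<union> C" by (auto simp: B_def)
    then show ?thesis using bridge[of "\<alpha> a" "\<alpha> a"] \<alpha>X[of a] ab
      by (intro bexI[of _ "\<alpha> a"]) auto
  qed
  then obtain u where u: "u \<in> B \<union> C" "d (\<alpha> a) u \<le> R" "joined P R (\<alpha> a) u" by blast
  have "\<exists>v\<in>B \<union> C. d (\<alpha> b) v \<le> R \<and> joined P R (\<alpha> b) v"
  proof (cases "s + 2 * R \<le> n")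
    case True
    obtain v where "v \<in> B \<union> C" "d (\<alpha> b) v \<le> R" using slim\<alpha>[of b] ab by (auto simp: B_def C_def)
    moreover have "d (\<alpha> b) p = 2 * R"
      using geodesic_dist'[OF \<alpha>, of s b] ab s True by (simp add: p_def b_def)
    ultimately show ?thesis using near_end[of "\<alpha> b" v] \<alpha>X[of b] ab BCX[of v] by auto
  next
    case False
    then have "\<alpha> b = \<gamma> l" using ends by (simp add: b_def)
    then have "\<alpha> b \<in> B \<union> C" by (auto simp: C_def)
    then show ?thesis using bridge[of "\<alpha> b" "\<alpha> b"] \<alpha>X[of b] ab
      by (intro bexI[of _ "\<alpha> b"]) auto
  qed
  then obtain v where v: "v \<in> B \<union> C" "d (\<alpha> b) v \<le> R" "joined P R (\<alpha> b) v" by blast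
  have uX: "u \<in> X" and vX: "v \<in> X" using u v BX CX by auto
  \<comment> \<open>A short path avoiding the ball around \<open>p\<close> that starts at
    \<open>\<alpha> a\<close> and returns to \<open>\<alpha>\<close> at or beyond \<open>s\<close>
    is a fat loop over the part of \<open>\<alpha>\<close> that it spans.\<close>
  have loop: False if "s \<le> c" "c \<le> n" "c - a \<le> 100 * R" "joined P k (\<alpha> a) (\<alpha> c)" "k \<le> 100 * R" for c k
  proof -
    have "geodesic (\<lambda>i. \<alpha> (a + i)) (c - a)" using geodesic_shift[OF \<alpha>] that ab by simp
    moreover have "joined (\<lambda>q. R \<le> 2 * d q (\<alpha> (a + (s - a)))) (100 * R) (\<alpha> (a + 0)) (\<alpha> (a + (c - a)))"
      using joined_mono[OF that(4,5)] that ab by (simp add: P_def p_def)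
    moreover have "s - a \<le> c - a" using that by simp
    ultimately show False using nf R that(3) unfolding no_fat_loops_def by blast
  qed
  have duv: "d u v \<le> 6 * R"
  proof -
    have "d u v \<le> d u (\<alpha> a) + d (\<alpha> a) v" "d (\<alpha> a) v \<le> d (\<alpha> a) (\<alpha> b) + d (\<alpha> b) v"
      using d_tri uX vX \<alpha>X ab by blast+
    moreover have "d u (\<alpha> a) = d (\<alpha> a) u" using d_sym uX \<alpha>X ab by blast
    moreover have "d (\<alpha> a) (\<alpha> b) = b - a" using geodesic_dist[OF \<alpha>] ab by simp
    ultimately show ?thesis using u v ab by linarith
  qed
  have close_loop: False if "joined P k u v" "k \<le> 90 * R" for k
  proof (rule loop[of b])
    show "joined P (R + k + R) (\<alpha> a) (\<alpha> b)"
      using joined_trans[OF joined_trans[OF u(3) that(1)] joined_sym[OF v(3)]] .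
  qed (use ab that in auto)
  \<comment> \<open>Either \<open>v\<close> lies on the side of \<open>u\<close>, and that side is
    followed from \<open>u\<close> to \<open>v\<close>, or the sides are changed at
    \<open>w\<close>. The length is at most \<open>27 * R\<close>, so \<open>close_loop\<close>
    applies.\<close>
  have cross: False if w: "w \<in> D" "w' \<in> E" "d w w' \<le> R" "d u w \<le> 20 * R" and uD: "u \<in> D"
    and DE: "D = B \<and> E = C \<or> D = C \<and> E = B" for w w' D E
  proof (cases "v \<in> D")
    case True
    then have "joined P (d u v) u v" using DE uD jB jC by blast
    then show False using close_loop[of "d u v"] duv by simp
  next
    case False
    then have vE: "v \<in> E" using DE v by blast
    have wX: "w \<in> X" "w' \<in> X" using w DE BX CX by auto
    have "joined P (d u w) u w" using DE uD w jB jC by blast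
    moreover have "joined P R w w'" using bridge w DE by blast
    moreover have "joined P (d w' v) w' v" using DE vE w jB jC by blast
    ultimately have "joined P (d u w + R + d w' v) u v" using joined_trans by blast
    moreover have "d w' v \<le> d w' u + d u v" "d w' u \<le> d w' w + d w u"
      using d_tri wX uX vX by blast+
    moreover have "d w' w = d w w'" "d w u = d u w" using d_sym wX uX by blast+
    ultimately show False using close_loop[of "d u w + R + d w' v"] w duv by simp
  qed
  \<comment> \<open>The other possibility: the walk along the side of \<open>u\<close> comes close
    to \<open>\<alpha>\<close> again, far beyond \<open>s\<close>, and closes a loop there without
    visiting \<open>v\<close>.\<close>
  have forward: False if w: "w \<in> D" "D = B \<or> D = C" "u \<in> D" "d u w \<le> 20 * R" "c \<le> n" "a + 18 * R \<le> c" "d w (\<alpha> c) \<le> R"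
    for w c D
  proof (rule loop[of c])
    have wX: "w \<in> X" and cX: "\<alpha> c \<in> X" using w BX CX \<alpha>X by auto
    have "s \<le> a + 2 * R" by (simp add: a_def)
    then have "d (\<alpha> c) p \<ge> 2 * R" using geodesic_dist'[OF \<alpha>, of s c] that by (simp add: p_def)
    then have "joined P R w (\<alpha> c)"
      using near_end[of "\<alpha> c" w] joined_sym wX cX w d_sym[of w "\<alpha> c"] by simp
    moreover have "joined P (d u w) u w" using w jB jC by blast
    ultimately show "joined P (R + (d u w + R)) (\<alpha> a) (\<alpha> c)" using u joined_trans by blast
    have "d (\<alpha> a) (\<alpha> c) \<le> d (\<alpha> a) u + d u (\<alpha> c)" "d u (\<alpha> c) \<le> d u w + d w (\<alpha> c)"
      using d_tri wX uX cX \<alpha>X ab by blast+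
    moreover have "d (\<alpha> a) (\<alpha> c) = c - a" using geodesic_dist[OF \<alpha>] that by simp
    ultimately show "c - a \<le> 100 * R" using w u by linarith
    show "s \<le> c" using that \<open>s \<le> a + 2 * R\<close> by simp
  qed (use w in auto)
  show False
  \<comment> \<open>Walk \<open>20 * R\<close> from \<open>u\<close> along its side, in the
    direction leading from \<open>\<alpha> 0\<close> over the third corner to
    \<open>\<alpha> n\<close>. Slimness at the point reached gives \<open>cross\<close> or
    \<open>forward\<close>; running out of side means reaching a corner, which lies on two
    sides.\<close>
  proof (cases "u \<in> B")
    case True
    then obtain k where k: "k \<le> m" "u = \<beta> k" by (auto simp: B_def)
    define k' where "k' = min (k + 20 * R) m"
    have k': "k \<le> k'" "k' \<le> m" using k by (auto simp: k'_def)
    then have duw: "d u (\<beta> k') \<le> 20 * R" using geodesic_dist[OF \<beta>, of k k'] k by (simp add: k'_def)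
    have wB: "\<beta> k' \<in> B" using k' by (auto simp: B_def)
    obtain q where q: "q \<in> \<alpha> ` {..n} \<union> C" "d (\<beta> k') q \<le> R" using slim\<beta>[OF k'(2)] by (auto simp: C_def)
    show False
    proof (cases "q \<in> C \<or> k' = m")
      case True
      then have "\<exists>w'\<in>C. d (\<beta> k') w' \<le> R"
      proof
        assume "k' = m"
        then have "\<beta> k' \<in> C" using ends by (auto simp: C_def)
        then show ?thesis using CX by (intro bexI[of _ "\<beta> k'"]) auto
      qed (use q in blast)
      then show False using cross[OF wB _ _ duw \<open>u \<in> B\<close>] by blast
    next
      case False
      then obtain c where c: "c \<le> n" "q = \<alpha> c" using q by auto
      have k20: "k' = k + 20 * R" using False by (auto simp: k'_def)
      \<comment> \<open>Compare distances from the common corner \<open>\<alpha> 0\<close>: those of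
        \<open>u\<close> and \<open>\<alpha> a\<close> differ by at most \<open>R\<close>, and so do
        those of \<open>\<beta> k'\<close> and \<open>\<alpha> c\<close>. Of the
        \<open>20 * R\<close> walked, \<open>18 * R\<close> remain as progress along
        \<open>\<alpha>\<close>.\<close>
      have "d (\<beta> 0) (\<beta> k') = k'" "d (\<beta> 0) u = k" "d (\<alpha> 0) (\<alpha> c) = c" "d (\<alpha> 0) (\<alpha> a) = a"
        using geodesic_dist[OF \<beta>, of 0] geodesic_dist[OF \<alpha>, of 0] k k' c ab by auto
      moreover have "d (\<alpha> 0) (\<beta> k') \<le> d (\<alpha> 0) (\<alpha> c) + d (\<alpha> c) (\<beta> k')"
        "d (\<alpha> 0) (\<alpha> a) \<le> d (\<alpha> 0) u + d u (\<alpha> a)"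
        using d_tri \<alpha>X c ab uX BX wB by blast+
      moreover have "d (\<alpha> c) (\<beta> k') = d (\<beta> k') (\<alpha> c)" "d u (\<alpha> a) = d (\<alpha> a) u"
        using d_sym \<alpha>X c ab uX BX wB by blast+
      ultimately have "a + 18 * R \<le> c" using k20 q c u ends by simp
      then show False using forward[OF wB _ \<open>u \<in> B\<close> duw c(1)] q c by simp
    qed
  next
    case False
    then have uC: "u \<in> C" using u by blast
    then obtain k where k: "k \<le> l" "u = \<gamma> k" by (auto simp: C_def)
    show False
    proof (cases "k + 20 * R \<le> l")
      case False
      have "joined P (d u (\<gamma> l)) u (\<gamma> l)" using jC uC by (auto simp: C_def)
      moreover have dl: "d u (\<gamma> l) \<le> 20 * R" using geodesic_dist[OF \<gamma>, of k l] k False by simp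
      ultimately have "joined P (R + d u (\<gamma> l)) (\<alpha> a) (\<alpha> n)" using u joined_trans ends by metis
      moreover have "d (\<alpha> a) (\<alpha> n) \<le> d (\<alpha> a) u + d u (\<alpha> n)" using d_tri uX \<alpha>X ab by blast
      moreover have "d (\<alpha> a) (\<alpha> n) = n - a" using geodesic_dist[OF \<alpha>] ab by simp
      ultimately show False using loop[of n "R + d u (\<gamma> l)"] s dl u ends by simp
    next
      case True
      define k' where "k' = k + 20 * R"
      have k': "k \<le> k'" "k' \<le> l" using k True by (auto simp: k'_def)
      then have duw: "d u (\<gamma> k') \<le> 20 * R" using geodesic_dist[OF \<gamma>, of k k'] k by (simp add: k'_def)
      have wC: "\<gamma> k' \<in> C" using k' by (auto simp: C_def)
      obtain q where q: "q \<in> \<alpha> ` {..n} \<union> B" "d (\<gamma> k') q \<le> R" using slim\<gamma>[OF k'(2)] by (auto simp: B_def)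
      show False
      proof (cases "q \<in> B")
        case True
        then show False using cross[OF wC _ _ duw uC] q by blast
      next
        case False
        then obtain c where c: "c \<le> n" "q = \<alpha> c" using q by auto
        \<comment> \<open>The same comparison, now with distances to the corner
          \<open>\<alpha> n\<close>.\<close>
        have "d (\<gamma> k') (\<gamma> l) = l - k'" "d u (\<gamma> l) = l - k" "d (\<alpha> c) (\<alpha> n) = n - c" "d (\<alpha> a) (\<alpha> n) = n - a"
          using geodesic_dist[OF \<gamma>, of _ l] geodesic_dist[OF \<alpha>, of _ n] k k' c ab by auto
        moreover have "d (\<alpha> c) (\<alpha> n) \<le> d (\<alpha> c) (\<gamma> k') + d (\<gamma> k') (\<alpha> n)"
          "d u (\<alpha> n) \<le> d u (\<alpha> a) + d (\<alpha> a) (\<alpha> n)"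
          using d_tri \<alpha>X c ab uX CX wC by blast+
        moreover have "d (\<alpha> c) (\<gamma> k') = d (\<gamma> k') (\<alpha> c)" "d u (\<alpha> a) = d (\<alpha> a) u"
          using d_sym \<alpha>X c ab uX CX wC by blast+
        ultimately have "a + 18 * R \<le> c" using q c u ends k k' ab by (simp add: k'_def)
        then show False using forward[OF wC _ uC duw c(1)] q c by simp
      qed
    qed
  qed
qed

text \<open>Take the least \<open>R\<close> for which all three sides are \<open>R\<close>-slim.
  Leastness provides a point on some side at distance at least \<open>R\<close> from the other two
  sides, and \<open>fat_side_bound\<close> bounds \<open>R\<close>. When that point is not on
  \<open>\<alpha>\<close>, the triangle is relabelled with one side reversed to meet the orientation
  required there.\<close>

lemma slim_triangle:
  assumes nf: "no_fat_loops R0"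
    and \<alpha>: "geodesic \<alpha> n" and \<beta>: "geodesic \<beta> m" and \<gamma>: "geodesic \<gamma> l"
    and ends: "\<beta> 0 = \<alpha> 0" "\<beta> m = \<gamma> 0" "\<gamma> l = \<alpha> n"
    and i: "i \<le> n"
  shows "\<exists>q\<in>\<beta> ` {..m} \<union> \<gamma> ` {..l}. d (\<alpha> i) q \<le> R0"
proof -
  define A where "A = \<alpha> ` {..n}"
  define B where "B = \<beta> ` {..m}"
  define C where "C = \<gamma> ` {..l}"
  define Q where "Q R \<longleftrightarrow> (\<forall>p\<in>A. \<exists>q\<in>B \<union> C. d p q \<le> R) \<and> (\<forall>p\<in>B. \<exists>q\<in>A \<union> C. d p q \<le> R) \<and>
    (\<forall>p\<in>C. \<exists>q\<in>A \<union> B. d p q \<le> R)" for R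
  have corners: "\<alpha> 0 \<in> A" "\<alpha> n \<in> A" "\<beta> 0 \<in> B" by (auto simp: A_def B_def)
  have "Q (n + m + l)"
    unfolding Q_def
  proof (intro conjI ballI)
    fix p assume "p \<in> A"
    then show "\<exists>q\<in>B \<union> C. d p q \<le> n + m + l"
      using geodesic_dist'[OF \<alpha>, of 0] corners ends(1) by (intro bexI[of _ "\<beta> 0"]) (auto simp: A_def)
  next
    fix p assume "p \<in> B"
    then show "\<exists>q\<in>A \<union> C. d p q \<le> n + m + l"
      using geodesic_dist'[OF \<beta>, of 0] ends corners by (intro bexI[of _ "\<alpha> 0"]) (auto simp: B_def)
  next
    fix p assume "p \<in> C"
    then show "\<exists>q\<in>A \<union> B. d p q \<le> n + m + l"
      using geodesic_dist[OF \<gamma>, of _ l] ends corners by (intro bexI[of _ "\<alpha> n"]) (auto simp: C_def)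
  qed
  define R where "R = (LEAST R. Q R)"
  have QR: "Q R" unfolding R_def using \<open>Q (n + m + l)\<close> by (rule LeastI)
  have "R \<le> R0"
  proof (rule ccontr)
    assume "\<not> R \<le> R0"
    then have "R \<noteq> 0" by simp
    then have "\<not> Q (R - 1)" using not_less_Least[of "R - 1" Q] by (simp add: R_def)
    moreover have "d p q \<le> R - 1 \<longleftrightarrow> \<not> R \<le> d p q" for p q using \<open>R \<noteq> 0\<close> by auto
    ultimately have "(\<exists>p\<in>A. \<forall>q\<in>B \<union> C. R \<le> d p q) \<or> (\<exists>p\<in>B. \<forall>q\<in>A \<union> C. R \<le> d p q) \<or>
      (\<exists>p\<in>C. \<forall>q\<in>A \<union> B. R \<le> d p q)"
      unfolding Q_def by auto
    then have "R \<le> R0"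
    proof (elim disjE bexE)
      fix p assume p: "p \<in> A" "\<forall>q\<in>B \<union> C. R \<le> d p q"
      then obtain s where "s \<le> n" "p = \<alpha> s" by (auto simp: A_def)
      then show "R \<le> R0"
        using fat_side_bound[OF nf \<alpha> \<beta> \<gamma> ends, of R s] QR p by (simp add: Q_def A_def B_def C_def)
    next
      fix p assume p: "p \<in> B" "\<forall>q\<in>A \<union> C. R \<le> d p q"
      then obtain s where s: "s \<le> m" "p = \<beta> s" by (auto simp: B_def)
      have [simp]: "(\<lambda>i. \<gamma> (l - i)) ` {..l} = C"
        unfolding C_def by (rule image_rev_atMost)
      show "R \<le> R0"
      proof (rule fat_side_bound[OF nf \<beta> \<alpha> geodesic_rev[OF \<gamma>]])
        show "\<exists>q\<in>\<beta> ` {..m} \<union> \<alpha> ` {..n}. d (\<gamma> (l - i)) q \<le> R" if "i \<le> l" for i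
          using QR unfolding Q_def A_def B_def C_def by (metis Un_commute atMost_iff diff_le_self imageI)
      qed (use ends QR p s in \<open>auto simp: Q_def simp flip: A_def B_def C_def, auto simp: A_def B_def C_def\<close>)
    next
      fix p assume p: "p \<in> C" "\<forall>q\<in>A \<union> B. R \<le> d p q"
      then obtain s where s: "s \<le> l" "p = \<gamma> s" by (auto simp: C_def)
      have [simp]: "(\<lambda>i. \<beta> (m - i)) ` {..m} = B"
        unfolding B_def by (rule image_rev_atMost)
      show "R \<le> R0"
      proof (rule fat_side_bound[OF nf \<gamma> geodesic_rev[OF \<beta>] \<alpha>])
        show "\<exists>q\<in>\<gamma> ` {..l} \<union> \<alpha> ` {..n}. d (\<beta> (m - i)) q \<le> R" if "i \<le> m" for i
          using QR unfolding Q_def A_def B_def C_def by (metis Un_commute atMost_iff diff_le_self imageI)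
      qed (use ends QR p s in \<open>auto simp: Q_def simp flip: A_def B_def C_def, auto simp: A_def B_def C_def, (metis Un_commute atMost_iff)+\<close>)
    qed
    then show False using \<open>\<not> R \<le> R0\<close> by simp
  qed
  then show ?thesis using QR i unfolding Q_def A_def B_def C_def by (meson UnCI atMost_iff imageI order_trans)
qed

end

section \<open>From slim triangles to the Gromov product inequality\<close>

context graph_metric begin

lemma geodesic_between:
  assumes "geodesic \<gamma> n" "q \<in> \<gamma> ` {..n}"
  shows "q \<in> X" "d (\<gamma> 0) q + d q (\<gamma> n) = d (\<gamma> 0) (\<gamma> n)"
  using assms by (auto simp: geodesic_def)

text \<open>Some point of \<open>\<alpha>\<close> is at distance from \<open>w\<close> at most the
  Gromov product of the ends plus \<open>2 * R0 + 1\<close>, with everything doubled here. The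
  witness is the last point of \<open>\<alpha>\<close> close to the side from
  \<open>\<alpha> 0\<close> to \<open>w\<close>: its successor must be close to the side from
  \<open>w\<close> to \<open>\<alpha> n\<close>.\<close>

lemma slim_triangle_centre:
  assumes nf: "no_fat_loops R0" and \<alpha>: "geodesic \<alpha> n" and w: "w \<in> X"
  shows "\<exists>i\<le>n. 2 * d (\<alpha> i) w + d (\<alpha> 0) (\<alpha> n) \<le> d (\<alpha> 0) w + d (\<alpha> n) w + 4 * R0 + 2"
proof -
  have X: "\<alpha> 0 \<in> X" "\<alpha> n \<in> X" using geodesic_in[OF \<alpha>] by auto
  obtain \<beta> where \<beta>: "geodesic \<beta> (d (\<alpha> 0) w)" "\<beta> 0 = \<alpha> 0" "\<beta> (d (\<alpha> 0) w) = w"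
    using geodesic_exists X w by blast
  obtain \<gamma> where \<gamma>: "geodesic \<gamma> (d w (\<alpha> n))" "\<gamma> 0 = w" "\<gamma> (d w (\<alpha> n)) = \<alpha> n"
    using geodesic_exists X w by blast
  define B where "B = \<beta> ` {..d (\<alpha> 0) w}"
  define C where "C = \<gamma> ` {..d w (\<alpha> n)}"
  have BX: "q \<in> X" "d (\<alpha> 0) q + d q w = d (\<alpha> 0) w" if "q \<in> B" for q
    using geodesic_between[OF \<beta>(1)] that \<beta> by (auto simp: B_def)
  have CX: "q \<in> X" "d w q + d q (\<alpha> n) = d w (\<alpha> n)" if "q \<in> C" for q
    using geodesic_between[OF \<gamma>(1)] that \<gamma> by (auto simp: C_def)
  define J where "J = {j. j \<le> n \<and> (\<exists>q\<in>B. d (\<alpha> j) q \<le> R0)}"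
  have "\<beta> 0 \<in> B" by (simp add: B_def)
  then have "0 \<in> J" using X \<beta>(2) by (auto simp: J_def intro!: bexI[of _ "\<beta> 0"])
  moreover have "finite J" by (simp add: J_def)
  ultimately have iJ: "Max J \<in> J" and max: "\<And>j. j \<in> J \<Longrightarrow> j \<le> Max J" using Max_in Max_ge by blast+
  define i where "i = Max J"
  obtain q where q: "i \<le> n" "q \<in> B" "d (\<alpha> i) q \<le> R0" using iJ by (auto simp: J_def i_def)
  have iX: "\<alpha> i \<in> X" using geodesic_in[OF \<alpha>] q by blast
  have "\<exists>q'\<in>C. d (\<alpha> i) q' \<le> R0 + 1"
  proof (cases "i = n")
    case True
    have "\<gamma> (d w (\<alpha> n)) \<in> C" by (simp add: C_def)
    then show ?thesis using True X \<gamma>(3) by (intro bexI[of _ "\<alpha> n"]) auto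
  next
    case False
    then have i1: "Suc i \<le> n" using q by simp
    have "Suc i \<notin> J" using max[of "Suc i"] i_def by auto
    then have "\<not> (\<exists>q\<in>B. d (\<alpha> (Suc i)) q \<le> R0)" using i1 by (simp add: J_def)
    then obtain q' where q': "q' \<in> C" "d (\<alpha> (Suc i)) q' \<le> R0"
      using slim_triangle[OF nf \<alpha> \<beta>(1) \<gamma>(1) _ _ _ i1] \<beta> \<gamma> unfolding B_def C_def by auto
    have "d (\<alpha> i) q' \<le> d (\<alpha> i) (\<alpha> (Suc i)) + d (\<alpha> (Suc i)) q'"
      using d_tri iX CX(1)[OF q'(1)] geodesic_in[OF \<alpha> i1] by blast
    moreover have "d (\<alpha> i) (\<alpha> (Suc i)) = 1" using geodesic_dist[OF \<alpha> _ i1, of i] by simp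
    ultimately show ?thesis using q' by (intro bexI[of _ q']) auto
  qed
  then obtain q' where q': "q' \<in> C" "d (\<alpha> i) q' \<le> R0 + 1" by blast
  have "d (\<alpha> 0) (\<alpha> i) \<le> d (\<alpha> 0) q + d q (\<alpha> i)" "d (\<alpha> i) w \<le> d (\<alpha> i) q + d q w"
    "d (\<alpha> i) (\<alpha> n) \<le> d (\<alpha> i) q' + d q' (\<alpha> n)" "d w (\<alpha> i) \<le> d w q' + d q' (\<alpha> i)"
    "d (\<alpha> 0) (\<alpha> n) \<le> d (\<alpha> 0) (\<alpha> i) + d (\<alpha> i) (\<alpha> n)"
    using d_tri BX(1)[OF q(2)] CX(1)[OF q'(1)] iX X w by blast+
  moreover have "d q (\<alpha> i) = d (\<alpha> i) q" "d q' (\<alpha> i) = d (\<alpha> i) q'" "d w (\<alpha> i) = d (\<alpha> i) w"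
    "d w (\<alpha> n) = d (\<alpha> n) w"
    using d_sym BX(1)[OF q(2)] CX(1)[OF q'(1)] iX X w by blast+
  ultimately have "2 * d (\<alpha> i) w + d (\<alpha> 0) (\<alpha> n) \<le> d (\<alpha> 0) w + d (\<alpha> n) w + 4 * R0 + 2"
    using BX(2)[OF q(2)] CX(2)[OF q'(1)] q q' by linarith
  then show ?thesis using q by blast
qed

text \<open>A Gromov product at \<open>w\<close> is at most the distance from \<open>w\<close> to
  any point \<open>q\<close> between the two points. Take \<open>q\<close> within \<open>R0\<close>
  of the centre \<open>\<alpha> i\<close> on one of the other two sides; the error is
  \<open>R0\<close> on top of the \<open>2 * R0 + 1\<close> for the centre.\<close>

lemma no_fat_loops_imp_hyperbolic:
  assumes nf: "no_fat_loops R0"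
  shows "gromov_hyperbolic_on X (\<lambda>x y. real (d x y))"
  unfolding gromov_hyperbolic_on_def
proof (intro exI[of _ "real (3 * R0 + 1)"] conjI ballI)
  fix x y z w assume X: "x \<in> X" "y \<in> X" "z \<in> X" "w \<in> X"
  obtain \<alpha> where \<alpha>: "geodesic \<alpha> (d x z)" "\<alpha> 0 = x" "\<alpha> (d x z) = z" using geodesic_exists X by blast
  obtain \<beta> where \<beta>: "geodesic \<beta> (d x y)" "\<beta> 0 = x" "\<beta> (d x y) = y" using geodesic_exists X by blast
  obtain \<gamma> where \<gamma>: "geodesic \<gamma> (d y z)" "\<gamma> 0 = y" "\<gamma> (d y z) = z" using geodesic_exists X by blast
  obtain i where i: "i \<le> d x z" "2 * d (\<alpha> i) w + d x z \<le> d x w + d z w + 4 * R0 + 2"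
    using slim_triangle_centre[OF nf \<alpha>(1) X(4)] \<alpha> by auto
  have iX: "\<alpha> i \<in> X" using geodesic_in[OF \<alpha>(1) i(1)] .
  obtain q where q: "q \<in> \<beta> ` {..d x y} \<union> \<gamma> ` {..d y z}" "d (\<alpha> i) q \<le> R0"
    using slim_triangle[OF nf \<alpha>(1) \<beta>(1) \<gamma>(1) _ _ _ i(1)] \<alpha> \<beta> \<gamma> by auto
  have "q \<in> X" and between: "d x q + d q y = d x y \<or> d y q + d q z = d y z"
    using q geodesic_between[OF \<beta>(1), of q] geodesic_between[OF \<gamma>(1), of q] \<beta> \<gamma> by auto
  have tri: "d q w \<le> d q (\<alpha> i) + d (\<alpha> i) w" "d x w \<le> d x q + d q w" "d y w \<le> d y q + d q w"
    "d z w \<le> d z q + d q w"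
    using d_tri \<open>q \<in> X\<close> iX X by blast+
  have sym: "d q (\<alpha> i) = d (\<alpha> i) q" "d y q = d q y" "d z q = d q z"
    using d_sym \<open>q \<in> X\<close> iX X by blast+
  from between have "d x w + d y w \<le> 2 * d (\<alpha> i) w + 2 * R0 + d x y \<or> d y w + d z w \<le> 2 * d (\<alpha> i) w + 2 * R0 + d y z"
  proof
    assume "d x q + d q y = d x y"
    then show ?thesis using tri sym q(2) by (intro disjI1) linarith
  next
    assume "d y q + d q z = d y z"
    then show ?thesis using tri sym q(2) by (intro disjI2) linarith
  qed
  then have "d x w + d y w + d x z \<le> d x y + d x w + d z w + 6 * R0 + 2 \<or>
    d y w + d z w + d x z \<le> d y z + d x w + d z w + 6 * R0 + 2"
    using i(2) by linarith
  then have "real (d x w + d y w + d x z) \<le> real (d x y + d x w + d z w + 6 * R0 + 2) \<or>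
    real (d y w + d z w + d x z) \<le> real (d y z + d x w + d z w + 6 * R0 + 2)"
    by (simp only: of_nat_le_iff)
  then show "min (gromov_product (\<lambda>x y. real (d x y)) w x y) (gromov_product (\<lambda>x y. real (d x y)) w y z)
      - real (3 * R0 + 1) \<le> gromov_product (\<lambda>x y. real (d x y)) w x z"
    unfolding gromov_product_def by (auto simp: min_le_iff_disj field_simps min_def)
qed simp

end

section \<open>Cochains on hyperbolic graphs\<close>

declare add_bit_eq_xor [simp del]

lemma bit_add_self_left [simp]: "a + (a + b) = (b :: bit)"
  by (cases a; cases b) simp_all

lemma bit_add_self [simp]: "a + a = (0 :: bit)"
  by (cases a) simp_all

lemma bit_add_eq_0D: "a + b = 0 \<Longrightarrow> a = (b :: bit)"
  by (cases a; cases b) simp_all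

section \<open>Hyperbolic graphs and the cohomology of their Rips complexes\<close>

locale hyperbolic_graph = graph_metric +
  fixes \<Delta> :: nat
  assumes four_point: "x \<in> X \<Longrightarrow> y \<in> X \<Longrightarrow> z \<in> X \<Longrightarrow> w \<in> X \<Longrightarrow>
    d x z + d y w \<le> max (d x y + d z w) (d y z + d x w) + \<Delta>"
begin

text \<open>Push \<open>v\<close> by \<open>h\<close> towards \<open>x0\<close>, or onto
  \<open>x0\<close> itself when it is within \<open>2 * h\<close>. By the four-point condition every
  neighbour of \<open>v\<close> that is no farther out than \<open>v\<close> stays a neighbour of
  \<open>v'\<close>, so the part of the link of \<open>v\<close> built so far is a cone with apex
  \<open>v'\<close>.\<close>

lemma rips_retraction:
  assumes x0: "x0 \<in> X" and h: "\<Delta> \<le> h" "1 \<le> h" and v: "v \<in> X" "v \<noteq> x0"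
  obtains v' where "v' \<in> X" "d x0 v' < d x0 v" "d v v' \<le> 2 * h"
    "\<And>b. b \<in> X \<Longrightarrow> d v b \<le> 2 * h \<Longrightarrow> d x0 b \<le> d x0 v \<Longrightarrow> d v' b \<le> 2 * h"
proof (cases "d x0 v \<le> 2 * h")
  case True
  have "d x0 v \<noteq> 0" using d_eq_0 x0 v by blast
  then show ?thesis using that[of x0] x0 v True d_sym[of v x0] by auto
next
  case False
  obtain \<gamma> where \<gamma>: "geodesic \<gamma> (d x0 v)" "\<gamma> 0 = x0" "\<gamma> (d x0 v) = v"
    using geodesic_exists x0 v by blast
  define v' where "v' = \<gamma> (d x0 v - h)"
  have v': "v' \<in> X" "d x0 v' = d x0 v - h" "d v v' = h"
    using geodesic_in[OF \<gamma>(1)] geodesic_dist[OF \<gamma>(1), of 0 "d x0 v - h"]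
      geodesic_dist'[OF \<gamma>(1), of "d x0 v - h" "d x0 v"] \<gamma> False by (auto simp: v'_def)
  show ?thesis
  proof (rule that[of v'])
    show "v' \<in> X" "d x0 v' < d x0 v" "d v v' \<le> 2 * h" using v' False h by auto
    fix b assume b: "b \<in> X" "d v b \<le> 2 * h" "d x0 b \<le> d x0 v"
    have "d v' b + d v x0 \<le> max (d v' v + d b x0) (d v b + d v' x0) + \<Delta>"
      by (rule four_point) (use b v v' x0 in auto)
    moreover have "d v' v = d v v'" "d b x0 = d x0 b" "d v' x0 = d x0 v'" "d v x0 = d x0 v"
      using d_sym v' v b x0 by blast+
    ultimately show "d v' b \<le> 2 * h" using b v' h False by (auto simp: max_def split: if_splits)
  qed
qed

text \<open>The Rips complex at scale \<open>2 * h\<close> is acyclic in degree two: a new vertex \<open>v\<close> of maximal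
  norm is pushed along the geodesic to the base point, and the primitive on the edges at \<open>v\<close> is
  forced by its values on the edges at the pushed vertex.\<close>
lemma rips_cocycle_extend:
  fixes \<omega> :: "'a \<Rightarrow> 'a \<Rightarrow> 'a \<Rightarrow> bit"
  assumes x0: "x0 \<in> X" and h: "\<Delta> \<le> h" "1 \<le> h"
    and \<omega>_sym: "\<And>a b c. \<omega> a b c = \<omega> b a c" "\<And>a b c. \<omega> a b c = \<omega> a c b"
    and \<omega>_deg: "\<And>a b. \<omega> a a b = 0"
    and cocycle: "\<And>a b c e. {a, b, c, e} \<subseteq> X \<Longrightarrow> (\<And>u v. u \<in> {a, b, c, e} \<Longrightarrow> v \<in> {a, b, c, e} \<Longrightarrow> d u v \<le> 2 * h)
      \<Longrightarrow> \<omega> b c e + \<omega> a c e + \<omega> a b e + \<omega> a b c = 0"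
    and \<theta>_sym: "\<And>a b. \<theta> a b = \<theta> b a" and \<theta>_deg: "\<And>a. \<theta> a a = 0"
    and AX: "A \<subseteq> X" and \<theta>: "\<And>a b c. a \<in> A \<Longrightarrow> b \<in> A \<Longrightarrow> c \<in> A \<Longrightarrow> d a b \<le> 2 * h \<Longrightarrow> d b c \<le> 2 * h \<Longrightarrow>
      d a c \<le> 2 * h \<Longrightarrow> \<theta> a b + \<theta> b c + \<theta> a c = \<omega> a b c"
    and v: "v \<in> X" "v \<notin> A" "v \<noteq> x0"
    and A: "\<And>b. b \<in> A \<Longrightarrow> d x0 b \<le> d x0 v" "\<And>b. b \<in> X \<Longrightarrow> d x0 b < d x0 v \<Longrightarrow> b \<in> A"
  shows "\<exists>\<theta>'. (\<forall>a b. \<theta>' a b = \<theta>' b a) \<and> (\<forall>a. \<theta>' a a = 0) \<and> (\<forall>a\<in>A. \<forall>b\<in>A. \<theta>' a b = \<theta> a b) \<and>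
    (\<forall>a\<in>insert v A. \<forall>b\<in>insert v A. \<forall>c\<in>insert v A. d a b \<le> 2 * h \<longrightarrow> d b c \<le> 2 * h \<longrightarrow> d a c \<le> 2 * h \<longrightarrow>
      \<theta>' a b + \<theta>' b c + \<theta>' a c = \<omega> a b c)"
proof -
  obtain w where w: "w \<in> X" "d x0 w < d x0 v" "d v w \<le> 2 * h"
    "\<And>b. b \<in> X \<Longrightarrow> d v b \<le> 2 * h \<Longrightarrow> d x0 b \<le> d x0 v \<Longrightarrow> d w b \<le> 2 * h"
    using rips_retraction[OF x0 h v(1,3)] by metis
  have wA: "w \<in> A" using A w by blast
  \<comment> \<open>The edge from \<open>v\<close> to \<open>w\<close> gets the value 0; the
    equation on the triangle \<open>v\<close>, \<open>w\<close>, \<open>b\<close> then determines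
    the value on every other edge at \<open>v\<close>.\<close>
  define \<theta>' where "\<theta>' a b = (if a = v \<and> b \<noteq> v then \<theta> w b + \<omega> v w b
    else if b = v \<and> a \<noteq> v then \<theta> w a + \<omega> v w a else \<theta> a b)" for a b
  have sym: "\<theta>' a b = \<theta>' b a" for a b using \<theta>_sym by (auto simp: \<theta>'_def)
  have deg: "\<theta>' a a = 0" for a using \<theta>_deg by (auto simp: \<theta>'_def)
  have old: "\<theta>' a b = \<theta> a b" if "a \<in> A" "b \<in> A" for a b using that v by (auto simp: \<theta>'_def)
  define T where "T a b c \<longleftrightarrow> \<theta>' a b + \<theta>' b c + \<theta>' a c = \<omega> a b c" for a b c
  have T1: "T a b c \<Longrightarrow> T b a c" for a b c unfolding T_def using sym \<omega>_sym by (metis add.commute add.left_commute)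
  have T2: "T a b c \<Longrightarrow> T a c b" for a b c unfolding T_def using sym \<omega>_sym by (metis add.commute add.left_commute)
  have Tdeg: "T a a b" for a b unfolding T_def using deg \<omega>_deg by simp
  have Tv: "T v b c" if bc: "b \<in> A" "c \<in> A" "d v b \<le> 2 * h" "d b c \<le> 2 * h" "d v c \<le> 2 * h" for b c
  proof -
    have X: "b \<in> X" "c \<in> X" using bc AX by auto
    have near: "d w b \<le> 2 * h" "d w c \<le> 2 * h" using w bc X A by blast+
    have "d p q \<le> 2 * h" if "p \<in> {v, w, b, c}" "q \<in> {v, w, b, c}" for p q
      using that near bc w v X d_sym[of v b] d_sym[of v c] d_sym[of v w] d_sym[of w b] d_sym[of w c] d_sym[of b c]
      by auto
    \<comment> \<open>The cocycle condition on the tetrahedron \<open>v\<close>, \<open>w\<close>,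
      \<open>b\<close>, \<open>c\<close>: three of its faces satisfy the equation, by construction
      or by assumption, and hence so does the face \<open>v\<close>, \<open>b\<close>,
      \<open>c\<close>.\<close>
    then have "\<omega> w b c + \<omega> v b c + \<omega> v w c + \<omega> v w b = 0" using cocycle[of v w b c] X v w by blast
    moreover have "\<theta> w b + \<theta> b c + \<theta> w c = \<omega> w b c" using \<theta>[OF wA bc(1,2)] near bc by blast
    moreover have "b \<noteq> v" "c \<noteq> v" using bc v by auto
    ultimately show ?thesis unfolding T_def \<theta>'_def
      by (cases "\<theta> w b"; cases "\<theta> w c"; cases "\<omega> v w b"; cases "\<omega> v w c"; cases "\<omega> v b c"; cases "\<omega> w b c"; cases "\<theta> b c") auto
  qed
  have T: "T a b c" if abc: "a \<in> insert v A" "b \<in> insert v A" "c \<in> insert v A" "d a b \<le> 2 * h" "d b c \<le> 2 * h" "d a c \<le> 2 * h" for a b c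
  proof -
    have X: "a \<in> X" "b \<in> X" "c \<in> X" using abc AX v by auto
    note s = d_sym[OF X(1,2)] d_sym[OF X(2,3)] d_sym[OF X(1,3)]
    consider "a = b" | "b = c" | "a = c" | "a \<noteq> b" "b \<noteq> c" "a \<noteq> c" by blast
    then show ?thesis
    proof cases
      case 2 then show ?thesis using Tdeg[of b a] T1 T2 by blast
    next
      case 3 then show ?thesis using Tdeg[of a b] T1 T2 by blast
    next
      case 4
      consider "a = v" | "b = v" | "c = v" | "a \<in> A" "b \<in> A" "c \<in> A" using abc by blast
      then show ?thesis
      proof cases
        case 1 then show ?thesis using Tv[of b c] abc 4 by auto
      next
        case 2 then show ?thesis using T1[OF Tv[of a c]] abc 4 s by auto
      next
        case 3 then show ?thesis using T2[OF T1[OF Tv[of a b]]] abc 4 s by auto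
      next
        case 4 then show ?thesis using \<theta> abc old unfolding T_def by simp
      qed
    qed (use Tdeg in simp)
  qed
  show ?thesis
  proof (intro exI[of _ \<theta>'] conjI allI ballI impI)
    fix a b c
    assume "a \<in> insert v A" "b \<in> insert v A" "c \<in> insert v A" "d a b \<le> 2 * h" "d b c \<le> 2 * h" "d a c \<le> 2 * h"
    then show "\<theta>' a b + \<theta>' b c + \<theta>' a c = \<omega> a b c" using T unfolding T_def by blast
  qed (fact sym deg old)+
qed

end

context hyperbolic_graph begin

text \<open>Vertices are added in order of distance from \<open>x0\<close>. Each sphere is finite,
  so it is absorbed by finitely many uses of \<open>rips_cocycle_extend\<close>. Extensions leave
  the values on the previous ball unchanged, and therefore the primitives on balls obtained by
  dependent choice glue together.\<close>

lemma rips_cocycle_exact: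
  fixes \<omega> :: "'a \<Rightarrow> 'a \<Rightarrow> 'a \<Rightarrow> bit"
  assumes x0: "x0 \<in> X" and h: "\<Delta> \<le> h" "1 \<le> h"
    and fin: "\<And>N. finite {x \<in> X. d x0 x \<le> N}"
    and \<omega>_sym: "\<And>a b c. \<omega> a b c = \<omega> b a c" "\<And>a b c. \<omega> a b c = \<omega> a c b"
    and \<omega>_deg: "\<And>a b. \<omega> a a b = 0"
    and cocycle: "\<And>a b c e. {a, b, c, e} \<subseteq> X \<Longrightarrow> (\<And>u v. u \<in> {a, b, c, e} \<Longrightarrow> v \<in> {a, b, c, e} \<Longrightarrow> d u v \<le> 2 * h)
      \<Longrightarrow> \<omega> b c e + \<omega> a c e + \<omega> a b e + \<omega> a b c = 0"
  shows "\<exists>\<theta>. (\<forall>a\<in>X. \<forall>b\<in>X. \<theta> a b = \<theta> b a) \<and> (\<forall>a\<in>X. \<theta> a a = 0) \<and>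
    (\<forall>a\<in>X. \<forall>b\<in>X. \<forall>c\<in>X. d a b \<le> 2 * h \<longrightarrow> d b c \<le> 2 * h \<longrightarrow> d a c \<le> 2 * h \<longrightarrow>
      \<theta> a b + \<theta> b c + \<theta> a c = \<omega> a b c)"
proof -
  define good where "good A \<theta> \<longleftrightarrow> (\<forall>a b. \<theta> a b = \<theta> b a) \<and> (\<forall>a. \<theta> a a = 0) \<and>
    (\<forall>a\<in>A. \<forall>b\<in>A. \<forall>c\<in>A. d a b \<le> 2 * h \<longrightarrow> d b c \<le> 2 * h \<longrightarrow> d a c \<le> 2 * h \<longrightarrow>
      \<theta> a b + \<theta> b c + \<theta> a c = \<omega> a b c)" for A and \<theta> :: "'a \<Rightarrow> 'a \<Rightarrow> bit"
  define Ball where "Ball N = {x \<in> X. d x0 x \<le> N}" for N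
  have step: "\<exists>\<theta>'. good (Ball N \<union> F) \<theta>' \<and> (\<forall>a\<in>Ball N. \<forall>b\<in>Ball N. \<theta>' a b = \<theta> a b)"
    if \<theta>: "good (Ball N) \<theta>" and "finite F" "F \<subseteq> {x \<in> X. d x0 x = Suc N}" for N F \<theta>
    using that(2,3)
  proof (induction F)
    case empty
    then show ?case using \<theta> by auto
  next
    case (insert v F)
    then obtain \<theta>1 where \<theta>1: "good (Ball N \<union> F) \<theta>1" "\<forall>a\<in>Ball N. \<forall>b\<in>Ball N. \<theta>1 a b = \<theta> a b"
      by auto
    have v: "v \<in> X" "d x0 v = Suc N" using insert by auto
    have "\<exists>\<theta>'. (\<forall>a b. \<theta>' a b = \<theta>' b a) \<and> (\<forall>a. \<theta>' a a = 0) \<and>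
      (\<forall>a\<in>Ball N \<union> F. \<forall>b\<in>Ball N \<union> F. \<theta>' a b = \<theta>1 a b) \<and>
      (\<forall>a\<in>insert v (Ball N \<union> F). \<forall>b\<in>insert v (Ball N \<union> F). \<forall>c\<in>insert v (Ball N \<union> F).
        d a b \<le> 2 * h \<longrightarrow> d b c \<le> 2 * h \<longrightarrow> d a c \<le> 2 * h \<longrightarrow> \<theta>' a b + \<theta>' b c + \<theta>' a c = \<omega> a b c)"
    proof (rule rips_cocycle_extend[OF x0 h \<omega>_sym \<omega>_deg cocycle])
      show "v \<notin> Ball N \<union> F" using v insert by (auto simp: Ball_def)
      show "v \<noteq> x0" using v x0 by auto
    qed (use \<theta>1(1) v insert.prems in \<open>auto simp: good_def Ball_def\<close>)
    then obtain \<theta>' where "good (insert v (Ball N \<union> F)) \<theta>'"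
      "\<forall>a\<in>Ball N \<union> F. \<forall>b\<in>Ball N \<union> F. \<theta>' a b = \<theta>1 a b"
      unfolding good_def by blast
    then show ?case using \<theta>1(2) by (intro exI[of _ \<theta>']) simp
  qed
  have "\<exists>\<Theta>. \<forall>N. good (Ball N) (\<Theta> N) \<and> (\<forall>a\<in>Ball N. \<forall>b\<in>Ball N. \<Theta> (Suc N) a b = \<Theta> N a b)"
  proof (rule dependent_nat_choice)
    have "Ball 0 = {x0}" using x0 d_eq_0[of x0] by (auto simp: Ball_def)
    then have "good (Ball 0) (\<lambda>_ _. 0)" using \<omega>_deg by (simp add: good_def)
    then show "\<exists>\<theta>. good (Ball 0) \<theta>" by blast
  next
    fix \<theta> N assume \<theta>: "good (Ball N) \<theta>"
    have "Ball (Suc N) = Ball N \<union> {x \<in> X. d x0 x = Suc N}" by (auto simp: Ball_def)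
    moreover have "finite {x \<in> X. d x0 x = Suc N}" by (rule finite_subset[OF _ fin[of "Suc N"]]) auto
    ultimately show "\<exists>\<theta>'. good (Ball (Suc N)) \<theta>' \<and> (\<forall>a\<in>Ball N. \<forall>b\<in>Ball N. \<theta>' a b = \<theta> a b)"
      using step[OF \<theta>, of "{x \<in> X. d x0 x = Suc N}"] by simp
  qed
  then obtain \<Theta> where \<Theta>: "\<And>N. good (Ball N) (\<Theta> N)"
    "\<And>N a b. a \<in> Ball N \<Longrightarrow> b \<in> Ball N \<Longrightarrow> \<Theta> (Suc N) a b = \<Theta> N a b" by blast
  have stable: "\<Theta> M a b = \<Theta> N a b" if "N \<le> M" "a \<in> Ball N" "b \<in> Ball N" for M N a b
    using that(1)
  proof (induction M rule: dec_induct)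
    case (step M)
    then have "a \<in> Ball M" "b \<in> Ball M" using that by (auto simp: Ball_def)
    then show ?case using \<Theta>(2) step by simp
  qed simp
  define \<theta> where "\<theta> a b = \<Theta> (max (d x0 a) (d x0 b)) a b" for a b
  have \<theta>eq: "\<theta> a b = \<Theta> N a b" if "a \<in> Ball N" "b \<in> Ball N" for a b N
    unfolding \<theta>_def by (rule stable[symmetric]) (use that in \<open>auto simp: Ball_def\<close>)
  have sym: "\<theta> a b = \<theta> b a" for a b
    using \<Theta>(1) by (simp add: \<theta>_def good_def max.commute)
  have "\<theta> a a = 0" for a using \<Theta>(1) by (simp add: \<theta>_def good_def)
  moreover have "\<theta> a b + \<theta> b c + \<theta> a c = \<omega> a b c"
    if "a \<in> X" "b \<in> X" "c \<in> X" "d a b \<le> 2 * h" "d b c \<le> 2 * h" "d a c \<le> 2 * h" for a b c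
  proof -
    define N where "N = max (d x0 a) (max (d x0 b) (d x0 c))"
    have "a \<in> Ball N" "b \<in> Ball N" "c \<in> Ball N" using that by (auto simp: Ball_def N_def)
    then show ?thesis using \<Theta>(1)[of N] \<theta>eq that unfolding good_def by simp
  qed
  ultimately show ?thesis using sym by blast
qed

text \<open>The hypothesis on \<open>j\<close> says that \<open>j\<close> is at most the Gromov
  product of the ends seen from the common start. A first use of the four-point condition gives
  \<open>d (\<alpha> j) (\<gamma> m) \<le> m - j + \<Delta>\<close>, a second one compares
  \<open>\<alpha> j\<close> with \<open>\<gamma> j\<close>.\<close>

lemma fellow_travel:
  assumes \<alpha>: "geodesic \<alpha> n" and \<gamma>: "geodesic \<gamma> m" and eq: "\<alpha> 0 = \<gamma> 0"
    and j: "2 * j + d (\<alpha> n) (\<gamma> m) \<le> n + m"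
  shows "d (\<alpha> j) (\<gamma> j) \<le> 2 * \<Delta>"
proof -
  have X: "\<alpha> 0 \<in> X" "\<alpha> n \<in> X" "\<gamma> m \<in> X" using geodesic_in[OF \<alpha>] geodesic_in[OF \<gamma>] by auto
  have len: "d (\<alpha> 0) (\<alpha> n) = n" "d (\<alpha> 0) (\<gamma> m) = m"
    using geodesic_dist[OF \<alpha>, of 0 n] geodesic_dist[OF \<gamma>, of 0 m] eq by auto
  have "n \<le> m + d (\<alpha> n) (\<gamma> m)" "m \<le> n + d (\<alpha> n) (\<gamma> m)"
    using d_tri[of "\<alpha> 0" "\<gamma> m" "\<alpha> n"] d_tri[of "\<alpha> 0" "\<alpha> n" "\<gamma> m"] d_sym X len by auto
  then have jn: "j \<le> n" "j \<le> m" using j by linarith+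
  have jX: "\<alpha> j \<in> X" "\<gamma> j \<in> X" using geodesic_in[OF \<alpha>] geodesic_in[OF \<gamma>] jn by auto
  have dj: "d (\<alpha> 0) (\<alpha> j) = j" "d (\<alpha> j) (\<alpha> n) = n - j" "d (\<alpha> 0) (\<gamma> j) = j" "d (\<gamma> j) (\<gamma> m) = m - j"
    using geodesic_dist[OF \<alpha>, of 0 j] geodesic_dist[OF \<alpha>, of j n] geodesic_dist[OF \<gamma>, of 0 j]
      geodesic_dist[OF \<gamma>, of j m] jn eq by auto
  have "d (\<alpha> j) (\<gamma> m) + d (\<alpha> n) (\<alpha> 0) \<le> max (d (\<alpha> j) (\<alpha> n) + d (\<gamma> m) (\<alpha> 0)) (d (\<alpha> n) (\<gamma> m) + d (\<alpha> j) (\<alpha> 0)) + \<Delta>"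
    by (rule four_point) (use jX X in auto)
  moreover have "d (\<alpha> j) (\<gamma> j) + d (\<gamma> m) (\<alpha> 0) \<le> max (d (\<alpha> j) (\<gamma> m) + d (\<gamma> j) (\<alpha> 0)) (d (\<gamma> m) (\<gamma> j) + d (\<alpha> j) (\<alpha> 0)) + \<Delta>"
    by (rule four_point) (use jX X in auto)
  moreover have "d (\<alpha> n) (\<alpha> 0) = n" "d (\<gamma> m) (\<alpha> 0) = m" "d (\<alpha> j) (\<alpha> 0) = j" "d (\<gamma> j) (\<alpha> 0) = j" "d (\<gamma> m) (\<gamma> j) = m - j"
    using d_sym X jX len dj by auto
  ultimately show ?thesis using dj j jn by (auto simp: max_def split: if_splits)
qed

end

section \<open>Hamming weights and path sums of families of cochains modulo two\<close>

definition wt :: "'i set \<Rightarrow> ('i \<Rightarrow> bit) \<Rightarrow> nat" where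
  "wt I f = card {i \<in> I. f i = 1}"

lemma wt_add:
  assumes "finite I" shows "wt I (\<lambda>i. f i + g i) \<le> wt I f + wt I g"
proof -
  have "{i \<in> I. f i + g i = 1} \<subseteq> {i \<in> I. f i = 1} \<union> {i \<in> I. g i = 1}"
    by (auto simp flip: bit_not_zero_iff)
  then have "card {i \<in> I. f i + g i = 1} \<le> card ({i \<in> I. f i = 1} \<union> {i \<in> I. g i = 1})"
    using assms by (intro card_mono) auto
  also have "\<dots> \<le> wt I f + wt I g" unfolding wt_def by (rule card_Un_le)
  finally show ?thesis by (simp add: wt_def)
qed

lemma wt_add_le:
  assumes "finite I" "wt I f \<le> m" "wt I g \<le> n" "\<And>i. i \<in> I \<Longrightarrow> k i = f i + g i"
  shows "wt I k \<le> m + n"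
proof -
  have "wt I k = wt I (\<lambda>i. f i + g i)" unfolding wt_def using assms(4) by (metis (lifting))
  then show ?thesis using wt_add[OF assms(1), of f g] assms by linarith
qed

lemma wt_zero [simp]: "wt I (\<lambda>_. 0) = 0"
  by (simp add: wt_def)

definition path_sum :: "('a \<Rightarrow> 'a \<Rightarrow> bit) \<Rightarrow> (nat \<Rightarrow> 'a) \<Rightarrow> nat \<Rightarrow> bit" where
  "path_sum \<theta> p n = (\<Sum>j<n. \<theta> (p j) (p (Suc j)))"

lemma path_sum_0 [simp]: "path_sum \<theta> p 0 = 0"
  and path_sum_Suc: "path_sum \<theta> p (Suc n) = path_sum \<theta> p n + \<theta> (p n) (p (Suc n))"
  by (simp_all add: path_sum_def)

lemma path_sum_add: "path_sum \<theta> p (m + n) = path_sum \<theta> p m + path_sum \<theta> (\<lambda>j. p (m + j)) n"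
  by (induction n) (simp_all add: path_sum_Suc ac_simps)

text \<open>Used to read a side of a triangle from both of its ends, as the legs at two
  corners.\<close>

lemma path_sum_split_rev:
  assumes "b \<le> n" "\<And>j. j < n \<Longrightarrow> \<theta> (p j) (p (Suc j)) = \<theta> (p (Suc j)) (p j)"
  shows "path_sum \<theta> p n = path_sum \<theta> p (n - b) + path_sum \<theta> (\<lambda>j. p (n - j)) b"
  using assms(1)
proof (induction b)
  case (Suc b)
  then have "n - b = Suc (n - Suc b)" by simp
  then have "path_sum \<theta> p (n - b) = path_sum \<theta> p (n - Suc b) + \<theta> (p (n - b)) (p (n - Suc b))"
    using assms(2)[of "n - Suc b"] Suc.prems by (simp add: path_sum_Suc)
  then show ?case using Suc by (simp add: path_sum_Suc ac_simps)
qed simp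

text \<open>The rounded Gromov product is the length of a leg of the comparison tripod. The rounding
  error is the parity of the perimeter, hence the same at all three corners.\<close>

lemma half_parity:
  assumes "m \<le> n + l"
  shows "2 * ((n + l - m) div 2) + (n + m + l) mod 2 + m = n + (l::nat)"
proof -
  obtain x where x: "n + l = m + x" using assms le_Suc_ex by blast
  then have sum: "n + m + l = 2 * m + x" by simp
  have "(n + m + l) mod 2 = x mod 2" unfolding sum by simp
  moreover have "n + l - m = x" using x by simp
  moreover have "2 * (x div 2) + x mod 2 = x" by simp
  ultimately show ?thesis using x by simp
qed

text \<open>\<open>small\<close> bounds the number of members of the family whose coboundary is
  nonzero on a given triangle of diameter at most \<open>r\<close>. A filling of a loop by small
  triangles thus bounds how many members are nonzero on the loop.\<close>

locale bounded_cochains = hyperbolic_graph +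
  fixes I :: "'i set" and \<theta> :: "'i \<Rightarrow> 'a \<Rightarrow> 'a \<Rightarrow> bit" and r \<kappa> :: nat
  assumes finI: "finite I"
    and r_large: "2 * \<Delta> + 2 \<le> r"
    and \<theta>_sym: "a \<in> X \<Longrightarrow> b \<in> X \<Longrightarrow> i \<in> I \<Longrightarrow> \<theta> i a b = \<theta> i b a"
    and \<theta>_deg: "a \<in> X \<Longrightarrow> i \<in> I \<Longrightarrow> \<theta> i a a = 0"
    and small: "a \<in> X \<Longrightarrow> b \<in> X \<Longrightarrow> c \<in> X \<Longrightarrow> d a b \<le> r \<Longrightarrow> d b c \<le> r \<Longrightarrow> d a c \<le> r \<Longrightarrow>
      wt I (\<lambda>i. \<theta> i a b + \<theta> i b c + \<theta> i a c) \<le> \<kappa>"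
begin

text \<open>A fan of triangles with apex \<open>p 0\<close>.\<close>

lemma cone_weight:
  assumes "\<And>i. i \<le> m \<Longrightarrow> p i \<in> X" "\<And>i j. i \<le> m \<Longrightarrow> j \<le> m \<Longrightarrow> d (p i) (p j) \<le> r"
  shows "wt I (\<lambda>i. \<theta> i (p 0) (p m) + path_sum (\<theta> i) p m) \<le> \<kappa> * m"
  using assms
proof (induction m)
  case 0
  have "wt I (\<lambda>i. \<theta> i (p 0) (p 0) + path_sum (\<theta> i) p 0) \<le> 0 + 0"
    by (rule wt_add_le[OF finI, of "\<lambda>_. 0" _ "\<lambda>_. 0"]) (use 0 \<theta>_deg in auto)
  then show ?case by simp
next
  case (Suc m)
  have "wt I (\<lambda>i. \<theta> i (p 0) (p (Suc m)) + path_sum (\<theta> i) p (Suc m)) \<le> \<kappa> * m + \<kappa>"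
  proof (rule wt_add_le[OF finI])
    show "wt I (\<lambda>i. \<theta> i (p 0) (p m) + path_sum (\<theta> i) p m) \<le> \<kappa> * m" using Suc by simp
    show "wt I (\<lambda>i. \<theta> i (p 0) (p m) + \<theta> i (p m) (p (Suc m)) + \<theta> i (p 0) (p (Suc m))) \<le> \<kappa>"
      by (rule small) (use Suc.prems in auto)
  qed (simp add: path_sum_Suc ac_simps)
  then show ?case by simp
qed

text \<open>Each square between consecutive rungs is cut into two triangles by a diagonal of length
  at most \<open>2 * \<Delta> + 1\<close>.\<close>

lemma ladder_weight:
  assumes "\<And>j. j \<le> m \<Longrightarrow> p j \<in> X" "\<And>j. j \<le> m \<Longrightarrow> q j \<in> X" "\<And>j. j \<le> m \<Longrightarrow> d (p j) (q j) \<le> 2 * \<Delta>"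
    and "\<And>j. j < m \<Longrightarrow> d (p j) (p (Suc j)) \<le> 1" "\<And>j. j < m \<Longrightarrow> d (q j) (q (Suc j)) \<le> 1"
  shows "wt I (\<lambda>i. path_sum (\<theta> i) p m + path_sum (\<theta> i) q m + \<theta> i (p 0) (q 0) + \<theta> i (p m) (q m)) \<le> 2 * \<kappa> * m"
  using assms
proof (induction m)
  case (Suc m)
  have X: "p m \<in> X" "p (Suc m) \<in> X" "q m \<in> X" "q (Suc m) \<in> X" using Suc.prems by auto
  have near: "d (p m) (q m) \<le> 2 * \<Delta>" "d (p (Suc m)) (q (Suc m)) \<le> 2 * \<Delta>"
    "d (p m) (p (Suc m)) \<le> 1" "d (q m) (q (Suc m)) \<le> 1" using Suc.prems by auto
  have "d (p (Suc m)) (q m) \<le> d (p (Suc m)) (p m) + d (p m) (q m)" using d_tri X by blast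
  then have diag: "d (p (Suc m)) (q m) \<le> r" using near d_sym[of "p (Suc m)" "p m"] X r_large by linarith
  have t1: "wt I (\<lambda>i. \<theta> i (p m) (p (Suc m)) + \<theta> i (p (Suc m)) (q m) + \<theta> i (p m) (q m)) \<le> \<kappa>"
    by (rule small) (use X near diag r_large in auto)
  have t2: "wt I (\<lambda>i. \<theta> i (p (Suc m)) (q m) + \<theta> i (q m) (q (Suc m)) + \<theta> i (p (Suc m)) (q (Suc m))) \<le> \<kappa>"
    by (rule small) (use X near diag r_large in auto)
  have IH: "wt I (\<lambda>i. path_sum (\<theta> i) p m + path_sum (\<theta> i) q m + \<theta> i (p 0) (q 0) + \<theta> i (p m) (q m)) \<le> 2 * \<kappa> * m"
    using Suc by simp
  have "wt I (\<lambda>i. path_sum (\<theta> i) p (Suc m) + path_sum (\<theta> i) q (Suc m) + \<theta> i (p 0) (q 0) + \<theta> i (p (Suc m)) (q (Suc m)))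
    \<le> (2 * \<kappa> * m + \<kappa>) + \<kappa>"
    by (rule wt_add_le[OF finI wt_add_le[OF finI IH t1 refl] t2]) (simp add: path_sum_Suc ac_simps)
  then show ?case by simp
qed simp

text \<open>A fan of four triangles at \<open>a\<close>. Its longest diagonal, of length at most
  \<open>2 * \<Delta> + 2\<close>, calls for the full strength of \<open>r_large\<close>.\<close>

lemma hexagon_weight:
  assumes X: "{a, b, c, e, f, g} \<subseteq> X"
    and "d a b \<le> 1" "d b c \<le> 2 * \<Delta>" "d c e \<le> 1" "d e f \<le> 2 * \<Delta>" "d g f \<le> 1" "d a g \<le> 2 * \<Delta>"
  shows "wt I (\<lambda>i. \<theta> i a b + \<theta> i b c + \<theta> i c e + \<theta> i e f + \<theta> i g f + \<theta> i a g) \<le> 4 * \<kappa>"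
proof -
  have ac: "d a c \<le> 2 * \<Delta> + 1" using d_tri[of a b c] assms by auto
  have ae: "d a e \<le> 2 * \<Delta> + 2" using d_tri[of a c e] ac assms by auto
  have af: "d a f \<le> 2 * \<Delta> + 1" using d_tri[of a g f] assms by auto
  have 1: "wt I (\<lambda>i. \<theta> i a b + \<theta> i b c + \<theta> i a c) \<le> \<kappa>"
    and 2: "wt I (\<lambda>i. \<theta> i a c + \<theta> i c e + \<theta> i a e) \<le> \<kappa>"
    and 3: "wt I (\<lambda>i. \<theta> i a e + \<theta> i e f + \<theta> i a f) \<le> \<kappa>"
    and 4: "wt I (\<lambda>i. \<theta> i a g + \<theta> i g f + \<theta> i a f) \<le> \<kappa>"
    by (rule small; use assms ac ae af r_large in auto)+
  have "wt I (\<lambda>i. \<theta> i a b + \<theta> i b c + \<theta> i c e + \<theta> i e f + \<theta> i g f + \<theta> i a g) \<le> (\<kappa> + \<kappa>) + (\<kappa> + \<kappa>)"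
    by (rule wt_add_le[OF finI wt_add_le[OF finI 1 2 refl] wt_add_le[OF finI 3 4 refl]])
      (simp add: ac_simps)
  then show ?thesis by simp
qed

text \<open>The triangle is compared with a tripod: adjacent legs at each corner fellow-travel and
  are filled by a ladder, and a hexagon remains in the middle. The number of small triangles is
  linear in the perimeter.\<close>

lemma triangle_weight:
  assumes \<alpha>: "geodesic \<alpha> n" and \<beta>: "geodesic \<beta> m" and \<gamma>: "geodesic \<gamma> l"
    and ends: "\<gamma> 0 = \<alpha> 0" "\<alpha> n = \<beta> 0" "\<beta> m = \<gamma> l"
  shows "wt I (\<lambda>i. path_sum (\<theta> i) \<alpha> n + path_sum (\<theta> i) \<beta> m + path_sum (\<theta> i) \<gamma> l) \<le> \<kappa> * (n + m + l + 4)"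
proof -
  have X: "\<alpha> 0 \<in> X" "\<alpha> n \<in> X" "\<beta> m \<in> X"
    using geodesic_in[OF \<alpha>] geodesic_in[OF \<beta>] by auto
  have len: "d (\<alpha> 0) (\<alpha> n) = n" "d (\<alpha> n) (\<beta> m) = m" "d (\<alpha> 0) (\<beta> m) = l"
    using geodesic_dist[OF \<alpha>, of 0 n] geodesic_dist[OF \<beta>, of 0 m] geodesic_dist[OF \<gamma>, of 0 l] ends by auto
  then have tri: "l \<le> n + m" "n \<le> l + m" "m \<le> n + l"
    using d_tri[of "\<alpha> 0" "\<alpha> n" "\<beta> m"] d_tri[of "\<alpha> 0" "\<beta> m" "\<alpha> n"] d_tri[of "\<alpha> n" "\<alpha> 0" "\<beta> m"] X d_sym by auto
  \<comment> \<open>The legs at the two ends of a side leave a middle edge uncovered exactly when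
    the perimeter is odd; \<open>\<epsilon>\<close> is the length of that edge, possibly
    zero.\<close>
  define \<epsilon> where "\<epsilon> = (n + m + l) mod 2"
  define a where "a = (n + l - m) div 2"
  define b where "b = (n + m - l) div 2"
  define c where "c = (m + l - n) div 2"
  have abc: "2 * a + \<epsilon> + m = n + l" "2 * b + \<epsilon> + l = n + m" "2 * c + \<epsilon> + n = m + l"
    using half_parity[of m n l] half_parity[of l n m] half_parity[of n m l] tri
    by (simp_all add: \<epsilon>_def a_def b_def c_def ac_simps)
  then have sides: "n = a + \<epsilon> + b" "m = b + \<epsilon> + c" "l = a + \<epsilon> + c" by linarith+
  have \<epsilon>: "\<epsilon> = 0 \<or> \<epsilon> = 1" unfolding \<epsilon>_def by presburger
  note rev = geodesic_rev[OF \<alpha>] geodesic_rev[OF \<beta>] geodesic_rev[OF \<gamma>]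
  have f1: "d (\<alpha> j) (\<gamma> j) \<le> 2 * \<Delta>" if "j \<le> a" for j
    by (rule fellow_travel[OF \<alpha> \<gamma>]) (use ends that abc len in auto)
  have f2: "d (\<alpha> (n - j)) (\<beta> j) \<le> 2 * \<Delta>" if "j \<le> b" for j
    by (rule fellow_travel[OF rev(1) \<beta>]) (use ends that abc len in auto)
  have f3: "d (\<beta> (m - j)) (\<gamma> (l - j)) \<le> 2 * \<Delta>" if "j \<le> c" for j
    by (rule fellow_travel[OF rev(2,3)])
      (use ends that abc len d_sym[of "\<alpha> 0" "\<alpha> n"] X in auto)
  have st: "d (\<xi> j) (\<xi> (Suc j)) \<le> 1" if "geodesic \<xi> k" "j < k" for \<xi> j k
    using geodesic_dist[OF that(1), of j "Suc j"] that by simp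
  have "wt I (\<lambda>i. path_sum (\<theta> i) \<alpha> a + path_sum (\<theta> i) \<gamma> a + \<theta> i (\<alpha> 0) (\<gamma> 0) + \<theta> i (\<alpha> a) (\<gamma> a)) \<le> 2 * \<kappa> * a"
    by (rule ladder_weight) (use f1 sides st[OF \<alpha>] st[OF \<gamma>] geodesic_in[OF \<alpha>] geodesic_in[OF \<gamma>] in auto)
  note L1 = this
  have "wt I (\<lambda>i. path_sum (\<theta> i) (\<lambda>j. \<alpha> (n - j)) b + path_sum (\<theta> i) \<beta> b + \<theta> i (\<alpha> (n - 0)) (\<beta> 0) + \<theta> i (\<alpha> (n - b)) (\<beta> b)) \<le> 2 * \<kappa> * b"
    by (rule ladder_weight) (use f2 sides st[OF rev(1)] st[OF \<beta>] geodesic_in[OF rev(1)] geodesic_in[OF \<beta>] in auto)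
  note L2 = this
  have "wt I (\<lambda>i. path_sum (\<theta> i) (\<lambda>j. \<beta> (m - j)) c + path_sum (\<theta> i) (\<lambda>j. \<gamma> (l - j)) c + \<theta> i (\<beta> (m - 0)) (\<gamma> (l - 0)) + \<theta> i (\<beta> (m - c)) (\<gamma> (l - c))) \<le> 2 * \<kappa> * c"
    by (rule ladder_weight) (use f3 sides st[OF rev(2)] st[OF rev(3)] geodesic_in[OF rev(2)] geodesic_in[OF rev(3)] in auto)
  note L3 = this
  have nb: "n - b = a + \<epsilon>" "m - c = b + \<epsilon>" "l - c = a + \<epsilon>" using sides by auto
  have "wt I (\<lambda>i. \<theta> i (\<alpha> a) (\<alpha> (a + \<epsilon>)) + \<theta> i (\<alpha> (a + \<epsilon>)) (\<beta> b) + \<theta> i (\<beta> b) (\<beta> (b + \<epsilon>)) + \<theta> i (\<beta> (b + \<epsilon>)) (\<gamma> (a + \<epsilon>))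
      + \<theta> i (\<gamma> a) (\<gamma> (a + \<epsilon>)) + \<theta> i (\<alpha> a) (\<gamma> a)) \<le> 4 * \<kappa>"
  proof (rule hexagon_weight)
    show "{\<alpha> a, \<alpha> (a + \<epsilon>), \<beta> b, \<beta> (b + \<epsilon>), \<gamma> (a + \<epsilon>), \<gamma> a} \<subseteq> X"
      using geodesic_in[OF \<alpha>] geodesic_in[OF \<beta>] geodesic_in[OF \<gamma>] sides by auto
    show "d (\<alpha> a) (\<alpha> (a + \<epsilon>)) \<le> 1" "d (\<beta> b) (\<beta> (b + \<epsilon>)) \<le> 1" "d (\<gamma> a) (\<gamma> (a + \<epsilon>)) \<le> 1"
      using geodesic_dist[OF \<alpha>, of a "a + \<epsilon>"] geodesic_dist[OF \<beta>, of b "b + \<epsilon>"] geodesic_dist[OF \<gamma>, of a "a + \<epsilon>"]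
        sides \<epsilon> by auto
    show "d (\<alpha> (a + \<epsilon>)) (\<beta> b) \<le> 2 * \<Delta>" using f2[of b] nb by simp
    show "d (\<beta> (b + \<epsilon>)) (\<gamma> (a + \<epsilon>)) \<le> 2 * \<Delta>" using f3[of c] nb by simp
    show "d (\<alpha> a) (\<gamma> a) \<le> 2 * \<Delta>" using f1[of a] by simp
  qed
  note H = this
  \<comment> \<open>For \<open>\<epsilon> = 0\<close> the middle edge is degenerate and contributes
    nothing, so both parities share one formula.\<close>
  have mid: "path_sum (\<theta> i) \<xi> (k + \<epsilon>) = path_sum (\<theta> i) \<xi> k + \<theta> i (\<xi> k) (\<xi> (k + \<epsilon>))" if "\<xi> k \<in> X" "i \<in> I" for \<xi> k i
    using \<epsilon> \<theta>_deg[OF that] by (auto simp: path_sum_Suc)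
  have split: "path_sum (\<theta> i) \<xi> N = path_sum (\<theta> i) \<xi> k + \<theta> i (\<xi> k) (\<xi> (k + \<epsilon>)) + path_sum (\<theta> i) (\<lambda>j. \<xi> (N - j)) k'"
    if g: "geodesic \<xi> N" and N: "N = k + \<epsilon> + k'" and i: "i \<in> I" for \<xi> N k k' i
  proof -
    have "path_sum (\<theta> i) \<xi> N = path_sum (\<theta> i) \<xi> (N - k') + path_sum (\<theta> i) (\<lambda>j. \<xi> (N - j)) k'"
      by (rule path_sum_split_rev) (use N i g geodesic_in[OF g] \<theta>_sym in auto)
    then show ?thesis using mid[of \<xi> k i] geodesic_in[OF g, of k] N i by simp
  qed
  have "wt I (\<lambda>i. path_sum (\<theta> i) \<alpha> n + path_sum (\<theta> i) \<beta> m + path_sum (\<theta> i) \<gamma> l) \<le> (2 * \<kappa> * a + 2 * \<kappa> * b) + (2 * \<kappa> * c + 4 * \<kappa>)"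
  proof (rule wt_add_le[OF finI wt_add_le[OF finI L1 L2 refl] wt_add_le[OF finI L3 H refl]])
    fix i assume i: "i \<in> I"
    have deg: "\<theta> i (\<alpha> 0) (\<gamma> 0) = 0" "\<theta> i (\<alpha> (n - 0)) (\<beta> 0) = 0" "\<theta> i (\<beta> (m - 0)) (\<gamma> (l - 0)) = 0"
      using \<theta>_deg X ends i by auto
    show "path_sum (\<theta> i) \<alpha> n + path_sum (\<theta> i) \<beta> m + path_sum (\<theta> i) \<gamma> l =
      path_sum (\<theta> i) \<alpha> a + path_sum (\<theta> i) \<gamma> a + \<theta> i (\<alpha> 0) (\<gamma> 0) + \<theta> i (\<alpha> a) (\<gamma> a) +
      (path_sum (\<theta> i) (\<lambda>j. \<alpha> (n - j)) b + path_sum (\<theta> i) \<beta> b + \<theta> i (\<alpha> (n - 0)) (\<beta> 0) + \<theta> i (\<alpha> (n - b)) (\<beta> b)) +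
      (path_sum (\<theta> i) (\<lambda>j. \<beta> (m - j)) c + path_sum (\<theta> i) (\<lambda>j. \<gamma> (l - j)) c + \<theta> i (\<beta> (m - 0)) (\<gamma> (l - 0)) + \<theta> i (\<beta> (m - c)) (\<gamma> (l - c)) +
      (\<theta> i (\<alpha> a) (\<alpha> (a + \<epsilon>)) + \<theta> i (\<alpha> (a + \<epsilon>)) (\<beta> b) + \<theta> i (\<beta> b) (\<beta> (b + \<epsilon>)) + \<theta> i (\<beta> (b + \<epsilon>)) (\<gamma> (a + \<epsilon>))
      + \<theta> i (\<gamma> a) (\<gamma> (a + \<epsilon>)) + \<theta> i (\<alpha> a) (\<gamma> a)))"
      unfolding deg nb split[OF \<alpha> sides(1) i] split[OF \<beta> sides(2) i] split[OF \<gamma> sides(3) i]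
      by (simp add: ac_simps)
  qed
  also have "\<dots> \<le> \<kappa> * (n + m + l + 4)"
  proof -
    have "2 * a + 2 * b + 2 * c + 4 \<le> n + m + l + 4" using sides by linarith
    then have "\<kappa> * (2 * a + 2 * b + 2 * c + 4) \<le> \<kappa> * (n + m + l + 4)" by (rule mult_left_mono) simp
    then show ?thesis by (simp add: algebra_simps)
  qed
  finally show ?thesis .
qed

text \<open>The loop is bisected recursively. Each bisection leaves a geodesic triangle on the two
  halves and their chord, and the perimeters at one level add up to O(2^k). The factor
  \<open>k + 1\<close> counts the levels, which gives an n log n bound on the filling.\<close>

lemma loop_weight:
  assumes K: "K \<le> r" and p: "\<And>j. p j \<in> X" "\<And>j. d (p j) (p (Suc j)) \<le> K"
    and n: "n \<le> 2 ^ k" and closed: "p n = p 0"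
  shows "wt I (\<lambda>i. path_sum (\<theta> i) p n) \<le> \<kappa> * (4 * K + 4) * ((k + 1) * 2 ^ k)"
proof -
  have "\<forall>x\<in>X. \<forall>y\<in>X. \<exists>\<gamma>. geodesic \<gamma> (d x y) \<and> \<gamma> 0 = x \<and> \<gamma> (d x y) = y"
    using geodesic_exists by blast
  then obtain g where g: "\<And>x y. x \<in> X \<Longrightarrow> y \<in> X \<Longrightarrow> geodesic (g x y) (d x y)"
    "\<And>x y. x \<in> X \<Longrightarrow> y \<in> X \<Longrightarrow> g x y 0 = x" "\<And>x y. x \<in> X \<Longrightarrow> y \<in> X \<Longrightarrow> g x y (d x y) = y"
    by metis
  define \<Phi> where "\<Phi> i x y = path_sum (\<theta> i) (g x y) (d x y)" for i x y
  define C where "C = \<kappa> * (4 * K + 4)"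
  have tri: "wt I (\<lambda>i. \<Phi> i x y + \<Phi> i y z + \<Phi> i x z) \<le> \<kappa> * (d x y + d y z + d x z + 4)"
    if "x \<in> X" "y \<in> X" "z \<in> X" for x y z
    unfolding \<Phi>_def by (rule triangle_weight) (use g that in auto)
  have dist: "d (p j) (p (j + n)) \<le> K * n" if pp: "\<And>j. p j \<in> X" "\<And>j. d (p j) (p (Suc j)) \<le> K" for p j n
  proof (induction n)
    case (Suc n)
    have "d (p j) (p (j + Suc n)) \<le> d (p j) (p (j + n)) + d (p (j + n)) (p (Suc (j + n)))"
      using d_tri pp(1) by simp
    then show ?case using Suc pp(2)[of "j + n"] by simp
  qed (use pp in simp)
  \<comment> \<open>For the induction the path need not be closed: it is compared with the chosen
    geodesic between its ends. A single edge is compared with its geodesic by a fan, as both have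
    diameter at most \<open>K \<le> r\<close>.\<close>
  have "wt I (\<lambda>i. path_sum (\<theta> i) p n + \<Phi> i (p 0) (p n)) \<le> C * ((k + 1) * 2 ^ k)"
    if "n \<le> 2 ^ k" "\<And>j. p j \<in> X" "\<And>j. d (p j) (p (Suc j)) \<le> K" for n k p
    using that
  proof (induction k arbitrary: n p)
    case 0
    then consider "n = 0" | "n = 1" by fastforce
    then show ?case
    proof cases
      case 1 then show ?thesis using 0 by (simp add: \<Phi>_def)
    next
      case 2
      have X: "p 0 \<in> X" "p 1 \<in> X" and dK: "d (p 0) (p 1) \<le> K" using 0(2) 0(3)[of 0] by auto
      have "wt I (\<lambda>i. \<theta> i (g (p 0) (p 1) 0) (g (p 0) (p 1) (d (p 0) (p 1))) + path_sum (\<theta> i) (g (p 0) (p 1)) (d (p 0) (p 1)))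
        \<le> \<kappa> * d (p 0) (p 1)"
      proof (rule cone_weight)
        fix i j assume ij: "i \<le> d (p 0) (p 1)" "j \<le> d (p 0) (p 1)"
        then show "d (g (p 0) (p 1) i) (g (p 0) (p 1) j) \<le> r"
          using geodesic_dist[OF g(1)[OF X], of i j] geodesic_dist'[OF g(1)[OF X], of j i] dK K by linarith
      qed (use geodesic_in[OF g(1)[OF X]] in auto)
      then have "wt I (\<lambda>i. \<theta> i (p 0) (p 1) + \<Phi> i (p 0) (p 1)) \<le> \<kappa> * d (p 0) (p 1)"
        using g[OF X] by (simp add: \<Phi>_def)
      also have "\<dots> \<le> C" unfolding C_def using dK by (intro mult_left_mono) auto
      finally show ?thesis using 2 by (simp add: path_sum_Suc)
    qed
  next
    case (Suc k)
    define n1 where "n1 = n div 2"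
    define n2 where "n2 = n - n1"
    have n12: "n = n1 + n2" "n1 \<le> 2 ^ k" "n2 \<le> 2 ^ k" using Suc.prems(1) by (auto simp: n1_def n2_def)
    define q where "q j = p (n1 + j)" for j
    have q: "q j \<in> X" "d (q j) (q (Suc j)) \<le> K" for j using Suc.prems by (auto simp: q_def)
    have h1: "wt I (\<lambda>i. path_sum (\<theta> i) p n1 + \<Phi> i (p 0) (p n1)) \<le> C * ((k + 1) * 2 ^ k)"
      using Suc n12 by blast
    have h2: "wt I (\<lambda>i. path_sum (\<theta> i) q n2 + \<Phi> i (q 0) (q n2)) \<le> C * ((k + 1) * 2 ^ k)"
      using Suc.IH[OF n12(3), of q] q by blast
    have h3: "wt I (\<lambda>i. \<Phi> i (p 0) (p n1) + \<Phi> i (p n1) (p n) + \<Phi> i (p 0) (p n))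
      \<le> \<kappa> * (d (p 0) (p n1) + d (p n1) (p n) + d (p 0) (p n) + 4)"
      using tri Suc.prems by blast
    have "d (p 0) (p n1) \<le> K * n1" "d (p n1) (p n) \<le> K * n2" "d (p 0) (p n) \<le> K * n"
      using dist[of p 0 n1] dist[of p n1 n2] dist[of p 0 n] Suc.prems n12 by auto
    then have "d (p 0) (p n1) + d (p n1) (p n) + d (p 0) (p n) + 4 \<le> 2 * (K * n) + 4"
      using n12 by (simp add: algebra_simps)
    also have "\<dots> \<le> 2 * (K * 2 ^ Suc k) + 4 * 2 ^ Suc k"
      using Suc.prems(1) by (intro add_mono mult_left_mono) auto
    also have "\<dots> \<le> (4 * K + 4) * 2 ^ Suc k" by (simp add: algebra_simps)
    finally have "\<kappa> * (d (p 0) (p n1) + d (p n1) (p n) + d (p 0) (p n) + 4) \<le> C * 2 ^ Suc k"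
      unfolding C_def mult.assoc by (intro mult_left_mono) auto
    then have h3': "wt I (\<lambda>i. \<Phi> i (p 0) (p n1) + \<Phi> i (p n1) (p n) + \<Phi> i (p 0) (p n)) \<le> C * 2 ^ Suc k"
      using h3 by linarith
    have "wt I (\<lambda>i. path_sum (\<theta> i) p n + \<Phi> i (p 0) (p n)) \<le> C * ((k + 1) * 2 ^ k) + C * ((k + 1) * 2 ^ k) + C * 2 ^ Suc k"
    proof (rule wt_add_le[OF finI wt_add_le[OF finI h1 h2 refl] h3'])
      fix i
      show "path_sum (\<theta> i) p n + \<Phi> i (p 0) (p n) = path_sum (\<theta> i) p n1 + \<Phi> i (p 0) (p n1) + (path_sum (\<theta> i) q n2 + \<Phi> i (q 0) (q n2)) +
        (\<Phi> i (p 0) (p n1) + \<Phi> i (p n1) (p n) + \<Phi> i (p 0) (p n))"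
        unfolding n12(1) path_sum_add q_def by (simp add: ac_simps)
    qed
    then show ?case by (simp add: algebra_simps)
  qed
  from this[of n k p] show ?thesis using p n closed by (simp add: \<Phi>_def C_def)
qed

end

section \<open>Absence of fat loops\<close>

text \<open>The final contradiction between R^2 and R log R, with \<open>2 ^ k\<close> in the role
  of R and one factor cancelled.\<close>

lemma linear_less_power: "\<exists>k0. \<forall>k\<ge>k0. C * (k + 1) < (2::nat) ^ k"
proof (intro exI allI impI)
  fix k assume "4 * C \<le> k"
  then show "C * (k + 1) < 2 ^ k"
  proof (induction k rule: dec_induct)
    case base
    have "C * (4 * C + 1) < (2 * C + 1) * (2 * C + 1)" by (simp add: algebra_simps)
    also have "\<dots> \<le> 2 ^ (2 * C) * 2 ^ (2 * C)"
    proof -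
      have "2 * C + 1 \<le> 2 ^ (2 * C)" using less_exp[of "2 * C"] by linarith
      then show ?thesis by (intro mult_mono) (simp_all only: zero_le)
    qed
    also have "\<dots> = 2 ^ (4 * C)" by (simp flip: power_add)
    finally show ?case .
  next
    case (step k)
    have "C * (Suc k + 1) \<le> 2 * (C * (k + 1))" by simp
    then show ?case using step by simp
  qed
qed

section \<open>Cochains detecting winding modulo two, and coarse simple connectivity\<close>

lemma of_bool_add_bit: "of_bool P + of_bool Q = (of_bool (P \<noteq> Q) :: bit)"
  by (cases P; cases Q) simp_all

lemma path_sum_telescope:
  fixes Q :: "'a \<Rightarrow> bool"
  shows "path_sum (\<lambda>a b. of_bool (Q a \<noteq> Q b)) p n = of_bool (Q (p 0) \<noteq> Q (p n))"
proof (induction n)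
  case (Suc n)
  show ?case unfolding path_sum_Suc Suc.IH of_bool_add_bit 
    by (cases "Q (p 0)"; cases "Q (p n)"; cases "Q (p (Suc n))") simp_all
qed simp

lemma path_sum_cong:
  assumes "\<And>j. j < n \<Longrightarrow> \<theta> (p j) (p (Suc j)) = \<theta>' (q j) (q (Suc j))"
  shows "path_sum \<theta> p n = path_sum \<theta>' q n"
  using assms by (simp add: path_sum_def)

text \<open>\<open>cut g f (s, t)\<close> counts modulo two how often the image of an edge under \<open>(g, f)\<close> crosses the
  half-line below \<open>(s + 1/2, t)\<close>; its coboundary is thus concentrated near \<open>(s, t)\<close>.\<close>
definition cut :: "('a \<Rightarrow> nat) \<Rightarrow> ('a \<Rightarrow> nat) \<Rightarrow> nat \<times> nat \<Rightarrow> 'a \<Rightarrow> 'a \<Rightarrow> bit" where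
  "cut g f i a b = of_bool ((g a \<le> fst i) \<noteq> (g b \<le> fst i) \<and> (f a \<le> snd i \<or> f b \<le> snd i))"

lemma cut_sym: "cut g f i a b = cut g f i b a"
  by (auto simp: cut_def)

lemma cut_deg [simp]: "cut g f i a a = 0"
  by (simp add: cut_def)

definition cobdry :: "('a \<Rightarrow> 'a \<Rightarrow> bit) \<Rightarrow> 'a \<Rightarrow> 'a \<Rightarrow> 'a \<Rightarrow> bit" where
  "cobdry \<phi> a b c = \<phi> a b + \<phi> b c + \<phi> a c"

text \<open>The coboundary vanishes on the triangle if \<open>fst i\<close> lies on one side of all
  three values of \<open>g\<close>, or if \<open>snd i\<close> is below all values of
  \<open>f\<close>, because \<open>cut\<close> is then zero on each edge. If \<open>snd i\<close> is
  at least all values of \<open>f\<close>, then \<open>cut\<close> is the coboundary of an indicator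
  function there. Only an \<open>L\<close> by \<open>L\<close> box of indices remains.\<close>

lemma cobdry_cut_weight:
  assumes I: "finite I" and g: "\<And>x y. {x, y} \<subseteq> {a, b, c} \<Longrightarrow> g x \<le> g y + L"
    and f: "\<And>x y. {x, y} \<subseteq> {a, b, c} \<Longrightarrow> f x \<le> f y + L"
  shows "wt I (\<lambda>i. cobdry (cut g f i) a b c) \<le> L * L"
proof -
  define mg where "mg = min (g a) (min (g b) (g c))"
  define mf where "mf = min (f a) (min (f b) (f c))"
  have le: "g a \<le> mg + L" "g b \<le> mg + L" "g c \<le> mg + L" "f a \<le> mf + L" "f b \<le> mf + L" "f c \<le> mf + L"
    using g f by (auto simp: mg_def mf_def min_def)
  have "{i \<in> I. cobdry (cut g f i) a b c = 1} \<subseteq> {mg..<mg + L} \<times> {mf..<mf + L}"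
  proof
    fix i assume "i \<in> {i \<in> I. cobdry (cut g f i) a b c = 1}"
    then have i: "cobdry (cut g f i) a b c = 1" by simp
    have "mg \<le> fst i"
    proof (rule ccontr)
      assume "\<not> mg \<le> fst i"
      then have "\<not> g a \<le> fst i" "\<not> g b \<le> fst i" "\<not> g c \<le> fst i" by (auto simp: mg_def)
      then show False using i by (simp add: cobdry_def cut_def)
    qed
    moreover have "fst i < mg + L"
    proof (rule ccontr)
      assume "\<not> fst i < mg + L"
      then have "g a \<le> fst i" "g b \<le> fst i" "g c \<le> fst i" using le by linarith+
      then show False using i by (simp add: cobdry_def cut_def)
    qed
    moreover have "mf \<le> snd i"
    proof (rule ccontr)
      assume "\<not> mf \<le> snd i"
      then have "\<not> f a \<le> snd i" "\<not> f b \<le> snd i" "\<not> f c \<le> snd i" by (auto simp: mf_def)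
      then show False using i by (simp add: cobdry_def cut_def)
    qed
    moreover have "snd i < mf + L"
    proof (rule ccontr)
      assume "\<not> snd i < mf + L"
      then have "f a \<le> snd i" "f b \<le> snd i" "f c \<le> snd i" using le by linarith+
      then show False using i
        by (cases "g a \<le> fst i"; cases "g b \<le> fst i"; cases "g c \<le> fst i") (simp_all add: cobdry_def cut_def)
    qed
    ultimately show "i \<in> {mg..<mg + L} \<times> {mf..<mf + L}" by (cases i) auto
  qed
  then have "card {i \<in> I. cobdry (cut g f i) a b c = 1} \<le> card ({mg..<mg + L} \<times> {mf..<mf + L})"
    by (intro card_mono) auto
  then show ?thesis by (simp add: wt_def card_cartesian_product)
qed

text \<open>Any \<open>2\<close>-cochain on a two-dimensional complex is a cocycle, since a \<open>3\<close>-simplex is mapped to it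
  with two coinciding vertices.\<close>
lemma degenerate_cocycle:
  fixes \<Psi> :: "'u \<Rightarrow> 'u \<Rightarrow> 'u \<Rightarrow> bit"
  assumes "\<And>x y z. \<Psi> x y z = \<Psi> y x z" "\<And>x y z. \<Psi> x y z = \<Psi> x z y" "\<And>x y. \<Psi> x x y = 0"
    and "a = b \<or> a = c \<or> a = e \<or> b = c \<or> b = e \<or> c = e"
  shows "\<Psi> b c e + \<Psi> a c e + \<Psi> a b e + \<Psi> a b c = 0"
proof -
  have 1: "\<Psi> x y x = 0" "\<Psi> y x x = 0" for x y using assms(1-3) by metis+
  have 2: "\<Psi> y z x = \<Psi> x y z" for x y z using assms(1,2) by metis
  show ?thesis using assms(4)
    by (elim disjE) (simp_all add: assms(3) 1 assms(1)[of b a] assms(2)[of a _ b] assms(2)[of _ c b] 2 ac_simps,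
        metis assms(1) bit_add_self, metis assms(2) bit_add_self)
qed

text \<open>A homological substitute for simple connectivity: closed \<open>1\<close>-cochains on the flag complex of
  \<open>near\<close> have no periods.\<close>
definition coarsely_simply_connected :: "'a set \<Rightarrow> ('a \<Rightarrow> 'a \<Rightarrow> nat) \<Rightarrow> ('a \<Rightarrow> 'a \<Rightarrow> bool) \<Rightarrow> bool" where
  "coarsely_simply_connected X e near \<longleftrightarrow> (\<forall>\<chi> p n.
     (\<forall>a\<in>X. \<forall>b\<in>X. \<chi> a b = \<chi> b a) \<longrightarrow> (\<forall>a\<in>X. \<chi> a a = 0) \<longrightarrow>
     (\<forall>a\<in>X. \<forall>b\<in>X. \<forall>c\<in>X. near a b \<longrightarrow> near b c \<longrightarrow> near a c \<longrightarrow> cobdry \<chi> a b c = 0) \<longrightarrow>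
     (\<forall>j. p j \<in> X) \<longrightarrow> (\<forall>j. e (p j) (p (Suc j)) \<le> 1) \<longrightarrow> p n = p 0 \<longrightarrow> path_sum \<chi> p n = 0)"

lemma coarsely_simply_connectedI:
  assumes "\<And>\<chi> p n. \<lbrakk>\<And>a b. a \<in> X \<Longrightarrow> b \<in> X \<Longrightarrow> \<chi> a b = \<chi> b a; \<And>a. a \<in> X \<Longrightarrow> \<chi> a a = 0;
      \<And>a b c. a \<in> X \<Longrightarrow> b \<in> X \<Longrightarrow> c \<in> X \<Longrightarrow> near a b \<Longrightarrow> near b c \<Longrightarrow> near a c \<Longrightarrow> cobdry \<chi> a b c = 0;
      \<And>j. p j \<in> X; \<And>j. e (p j) (p (Suc j)) \<le> 1; p n = p 0\<rbrakk> \<Longrightarrow> path_sum \<chi> p n = 0"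
  shows "coarsely_simply_connected X e near"
  unfolding coarsely_simply_connected_def
proof (intro allI impI)
  fix \<chi> p n
  assume "\<forall>a\<in>X. \<forall>b\<in>X. \<chi> a b = \<chi> b a" "\<forall>a\<in>X. \<chi> a a = 0"
    "\<forall>a\<in>X. \<forall>b\<in>X. \<forall>c\<in>X. near a b \<longrightarrow> near b c \<longrightarrow> near a c \<longrightarrow> cobdry \<chi> a b c = 0"
    "\<forall>j. p j \<in> X" "\<forall>j. e (p j) (p (Suc j)) \<le> 1" "p n = p 0"
  then show "path_sum \<chi> p n = 0" by (intro assms) simp_all
qed

lemma coarsely_simply_connectedD:
  assumes "coarsely_simply_connected X e near"
    and "\<And>a b. a \<in> X \<Longrightarrow> b \<in> X \<Longrightarrow> \<chi> a b = \<chi> b a" "\<And>a. a \<in> X \<Longrightarrow> \<chi> a a = 0"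
    and "\<And>a b c. a \<in> X \<Longrightarrow> b \<in> X \<Longrightarrow> c \<in> X \<Longrightarrow> near a b \<Longrightarrow> near b c \<Longrightarrow> near a c \<Longrightarrow> cobdry \<chi> a b c = 0"
    and "\<And>j. p j \<in> X" "\<And>j. e (p j) (p (Suc j)) \<le> 1" "p n = p 0"
  shows "path_sum \<chi> p n = 0"
  by (rule assms(1)[unfolded coarsely_simply_connected_def, rule_format]) (use assms in simp_all)

text \<open>With more triangles imposing the closedness condition, fewer cochains have to be
  tested.\<close>

lemma coarsely_simply_connected_mono:
  assumes "coarsely_simply_connected X e near" "\<And>a b. a \<in> X \<Longrightarrow> b \<in> X \<Longrightarrow> near a b \<Longrightarrow> near' a b"
  shows "coarsely_simply_connected X e near'"
proof (rule coarsely_simply_connectedI)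
  fix \<chi> :: "'a \<Rightarrow> 'a \<Rightarrow> bit" and p and n :: nat
  assume *: "\<And>a b. a \<in> X \<Longrightarrow> b \<in> X \<Longrightarrow> \<chi> a b = \<chi> b a" "\<And>a. a \<in> X \<Longrightarrow> \<chi> a a = 0"
    "\<And>a b c. a \<in> X \<Longrightarrow> b \<in> X \<Longrightarrow> c \<in> X \<Longrightarrow> near' a b \<Longrightarrow> near' b c \<Longrightarrow> near' a c \<Longrightarrow> cobdry \<chi> a b c = 0"
    "\<And>j. p j \<in> X" "\<And>j. e (p j) (p (Suc j)) \<le> 1" "p n = p 0"
  have "cobdry \<chi> a b c = 0" if "a \<in> X" "b \<in> X" "c \<in> X" "near a b" "near b c" "near a c" for a b c
    by (rule *(3)) (use that assms(2) in simp_all)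
  from coarsely_simply_connectedD[OF assms(1) *(1,2) this *(4-6)] show "path_sum \<chi> p n = 0" .
qed

text \<open>The geometric core, with the subgroup replaced by a subset \<open>Y\<close> having its
  own graph metric. \<open>lip\<close> and \<open>proper\<close> say that the inclusion is a coarse
  embedding. A fat loop makes quadratically many cochains nonzero on itself, whereas
  \<open>loop_weight\<close> admits only R log R of them.\<close>

theorem no_fat_loops_of_filling:
  fixes X Y :: "'a set" and d e :: "'a \<Rightarrow> 'a \<Rightarrow> nat"
  assumes X: "hyperbolic_graph X d \<Delta>" and Y: "graph_metric Y e" and YX: "Y \<subseteq> X" and x0: "x0 \<in> X"
    and fin: "\<And>N. finite {x \<in> X. d x0 x \<le> N}"
    and lip: "\<And>a b. a \<in> Y \<Longrightarrow> b \<in> Y \<Longrightarrow> d a b \<le> K * e a b"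
    and proper: "\<And>N. \<exists>L. \<forall>a\<in>Y. \<forall>b\<in>Y. d a b \<le> N \<longrightarrow> e a b \<le> L"
    and asdim: "\<And>r. \<exists>(\<pi> :: 'a \<Rightarrow> 'u) D. (\<forall>a\<in>X. \<forall>b\<in>X. \<pi> a = \<pi> b \<longrightarrow> d a b \<le> D) \<and>
      (\<forall>a b c e. {a, b, c, e} \<subseteq> X \<longrightarrow> (\<forall>u\<in>{a, b, c, e}. \<forall>v\<in>{a, b, c, e}. d u v \<le> r) \<longrightarrow>
        \<pi> a = \<pi> b \<or> \<pi> a = \<pi> c \<or> \<pi> a = \<pi> e \<or> \<pi> b = \<pi> c \<or> \<pi> b = \<pi> e \<or> \<pi> c = \<pi> e)"
    and simply_connected: "coarsely_simply_connected Y e (\<lambda>a b. d a b \<le> r0)"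
  shows "\<exists>R0. graph_metric.no_fat_loops Y e R0"
proof -
  interpret X: hyperbolic_graph X d \<Delta> by (rule X)
  interpret Y: graph_metric Y e by (rule Y)
  \<comment> \<open>The Rips scale \<open>2 * h\<close> has to exceed the thresholds of
    \<open>rips_cocycle_exact\<close> and \<open>bounded_cochains\<close>, the length of an edge of
    \<open>Y\<close> seen in \<open>X\<close>, and the scale of simple connectivity.\<close>
  define h where "h = \<Delta> + K + r0 + 1"
  define r where "r = 2 * h"
  have hr: "\<Delta> \<le> h" "1 \<le> h" "K \<le> r" "r0 \<le> r" "2 * \<Delta> + 2 \<le> r" by (auto simp: h_def r_def)
  obtain \<pi> :: "'a \<Rightarrow> 'u" and D where \<pi>D: "\<And>a b. a \<in> X \<Longrightarrow> b \<in> X \<Longrightarrow> \<pi> a = \<pi> b \<Longrightarrow> d a b \<le> D"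
    and dim2: "\<And>a b c e. {a, b, c, e} \<subseteq> X \<Longrightarrow> \<forall>u\<in>{a, b, c, e}. \<forall>v\<in>{a, b, c, e}. d u v \<le> r \<Longrightarrow>
        \<pi> a = \<pi> b \<or> \<pi> a = \<pi> c \<or> \<pi> a = \<pi> e \<or> \<pi> b = \<pi> c \<or> \<pi> b = \<pi> e \<or> \<pi> c = \<pi> e"
    using asdim[of r] by blast
  \<comment> \<open>Points at distance at most \<open>r\<close> move by at most \<open>D\<close>
    each when replaced by representatives in \<open>Y\<close>, hence
    \<open>2 * D + r\<close>.\<close>
  obtain L where L: "\<And>a b. a \<in> Y \<Longrightarrow> b \<in> Y \<Longrightarrow> d a b \<le> 2 * D + r \<Longrightarrow> e a b \<le> L"
    using proper[of "2 * D + r"] by blast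
  define M where "M = \<pi> ` Y"
  define \<sigma> where "\<sigma> u = (SOME y. y \<in> Y \<and> \<pi> y = u)" for u
  define \<rho> where "\<rho> a = \<sigma> (\<pi> a)" for a
  have \<sigma>: "\<sigma> u \<in> Y" "\<pi> (\<sigma> u) = u" if "u \<in> M" for u
  proof -
    have "\<exists>y. y \<in> Y \<and> \<pi> y = u" using that by (auto simp: M_def)
    then have "\<sigma> u \<in> Y \<and> \<pi> (\<sigma> u) = u" unfolding \<sigma>_def by (rule someI_ex)
    then show "\<sigma> u \<in> Y" "\<pi> (\<sigma> u) = u" by auto
  qed
  have \<rho>d: "\<rho> a \<in> Y" "d a (\<rho> a) \<le> D" if "a \<in> X" "\<pi> a \<in> M" for a
    using \<sigma>[OF that(2)] \<pi>D[of a "\<sigma> (\<pi> a)"] that YX by (auto simp: \<rho>_def)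
  have \<rho>near: "e (\<rho> a) (\<rho> b) \<le> L" if ab: "a \<in> X" "b \<in> X" "\<pi> a \<in> M" "\<pi> b \<in> M" "d a b \<le> r" for a b
  proof (rule L)
    show Y: "\<rho> a \<in> Y" "\<rho> b \<in> Y" using \<rho>d ab by auto
    have "d (\<rho> a) (\<rho> b) \<le> d (\<rho> a) a + d a (\<rho> b)" "d a (\<rho> b) \<le> d a b + d b (\<rho> b)"
      using X.d_tri Y YX ab by blast+
    moreover have "d (\<rho> a) a = d a (\<rho> a)" using X.d_sym Y YX ab by blast
    ultimately show "d (\<rho> a) (\<rho> b) \<le> 2 * D + r" using \<rho>d(2)[of a] \<rho>d(2)[of b] ab by linarith
  qed
  have YM: "\<pi> a \<in> M" if "a \<in> Y" for a using that by (simp add: M_def)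
  have \<rho>Y: "\<rho> a \<in> Y" "e a (\<rho> a) \<le> L" if "a \<in> Y" for a
  proof -
    show "\<rho> a \<in> Y" using \<rho>d YM YX that by blast
    then show "e a (\<rho> a) \<le> L" using L[of a "\<rho> a"] \<rho>d(2)[of a] YM YX that by fastforce
  qed
  define \<kappa> where "\<kappa> = L * L"
  \<comment> \<open>The numerical factor is 6400 squared: below, \<open>2 ^ k \<le> 400 * R\<close>
    and \<open>R \<le> 16 * q\<close>.\<close>
  define C where "C = 40960000 * (\<kappa> * (4 * K + 4))"
  obtain k0 where k0: "\<And>k. k0 \<le> k \<Longrightarrow> C * (k + 1) < 2 ^ k" using linear_less_power by blast
  \<comment> \<open>The first summand forces \<open>k0 \<le> k\<close>, the second makes
    displacements by \<open>L\<close> negligible against \<open>R\<close>, and the third makes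
    \<open>q\<close> positive.\<close>
  define R0 where "R0 = 2 ^ k0 + 48 * L + 8"
  have "Y.no_fat_loops R0"
    unfolding Y.no_fat_loops_def
  proof (intro allI impI notI)
    fix R \<alpha> n s
    assume R: "R0 < R" and \<alpha>: "Y.geodesic \<alpha> n" and s: "s \<le> n" and n: "n \<le> 100 * R"
      and join: "Y.joined (\<lambda>q. R \<le> 2 * e q (\<alpha> s)) (100 * R) (\<alpha> 0) (\<alpha> n)"
    obtain \<eta> m where m: "m \<le> 100 * R" and \<eta>: "\<eta> 0 = \<alpha> 0" "\<eta> m = \<alpha> n" "\<And>i. i \<le> m \<Longrightarrow> \<eta> i \<in> Y"
      "\<And>i. i \<le> m \<Longrightarrow> R \<le> 2 * e (\<eta> i) (\<alpha> s)" "\<And>i. i < m \<Longrightarrow> e (\<eta> i) (\<eta> (Suc i)) \<le> 1"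
      using join unfolding Y.joined_def by blast
    have \<alpha>Y: "\<alpha> i \<in> Y" if "i \<le> n" for i using Y.geodesic_in[OF \<alpha> that] .
    have s_mid: "R \<le> 2 * s" "R + 2 * s \<le> 2 * n"
      using \<eta>(4)[of 0] \<eta>(4)[of m] \<eta>(1,2) Y.geodesic_dist[OF \<alpha>, of 0 s] Y.geodesic_dist'[OF \<alpha>, of s n] s by auto
    \<comment> \<open>The loop runs along \<open>\<alpha>\<close> and back along
      \<open>\<eta>\<close>. By truncated subtraction it rests at \<open>\<eta> 0\<close>
      afterwards, so the conditions on \<open>p\<close> hold for all indices.\<close>
    define p where "p j = (if j \<le> n then \<alpha> j else \<eta> (n + m - j))" for j
    have pY: "p j \<in> Y" for j using \<alpha>Y \<eta>(3) by (auto simp: p_def)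
    have p\<eta>: "p (n + j) = \<eta> (m - j)" for j using \<eta>(2) by (simp add: p_def)
    have \<eta>back: "e (\<eta> (m - j)) (\<eta> (m - Suc j)) \<le> 1" for j
    proof (cases "j < m")
      case True
      then have "Suc (m - Suc j) = m - j" by simp
      then show ?thesis using \<eta>(5)[of "m - Suc j"] Y.d_sym[of "\<eta> (m - j)" "\<eta> (m - Suc j)"] \<eta>(3) True by simp
    next
      case False then show ?thesis using \<eta>(3)[of 0] by simp
    qed
    have p1: "e (p j) (p (Suc j)) \<le> 1" for j
    proof (cases "j < n")
      case True then show ?thesis using Y.geodesic_dist[OF \<alpha>, of j "Suc j"] by (simp add: p_def)
    next
      case False
      then obtain i where i: "j = n + i" using le_iff_add not_less by blast
      show ?thesis using p\<eta>[of i] p\<eta>[of "Suc i"] \<eta>back[of i] i by simp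
    qed
    have pclosed: "p (n + m) = p 0" using p\<eta>[of m] \<eta>(1) by (simp add: p_def)
    define g where "g x = e (\<alpha> 0) x" for x
    define f where "f x = Min ((\<lambda>j. e x (\<alpha> j)) ` {..n})" for x
    have f_le: "f x \<le> t \<longleftrightarrow> (\<exists>j\<le>n. e x (\<alpha> j) \<le> t)" for x t
      unfolding f_def by (subst Min_le_iff) auto
    have gL: "g x \<le> g y + l" if "x \<in> Y" "y \<in> Y" "e x y \<le> l" for x y l
      using Y.d_tri[of "\<alpha> 0" y x] Y.d_sym[of x y] \<alpha>Y[of 0] that by (simp add: g_def)
    have fL: "f x \<le> f y + l" if "x \<in> Y" "y \<in> Y" "e x y \<le> l" for x y l
    proof -
      obtain j where j: "j \<le> n" "e y (\<alpha> j) \<le> f y" using f_le[of y "f y"] by auto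
      then have "e x (\<alpha> j) \<le> f y + l" using Y.d_tri[of x y "\<alpha> j"] \<alpha>Y that by fastforce
      then show ?thesis using f_le j by blast
    qed
    define q where "q = R div 8"
    \<comment> \<open>Heights start at \<open>L\<close> because \<open>\<rho>\<close> moves points
      of \<open>\<alpha>\<close> by up to \<open>L\<close>: the displaced geodesic still passes
      below all lattice points.\<close>
    define I where "I = {s..<s + q} \<times> {L..<L + q}"
    have Rq: "8 * q \<le> R" "R \<le> 16 * q" "48 * L < R" "2 ^ k0 < R"
    proof -
      have "8 \<le> R" using R by (simp add: R0_def)
      then show "8 * q \<le> R" "R \<le> 16 * q" unfolding q_def by presburger+
    qed (use R in \<open>auto simp: R0_def\<close>)
    define \<phi> where "\<phi> i = cut g f i" for i
    define \<phi>' where "\<phi>' i a b = \<phi> i (\<rho> a) (\<rho> b)" for i a b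
    \<comment> \<open>Extension by zero to pieces that miss \<open>Y\<close> needs no compatibility
      condition, as the pullback of any symmetric cochain on pieces vanishing on degenerate triples
      is a cocycle at scale \<open>r\<close>.\<close>
    define \<Psi> where "\<Psi> i u v w = (if u \<in> M \<and> v \<in> M \<and> w \<in> M then cobdry (\<phi> i) (\<sigma> u) (\<sigma> v) (\<sigma> w) else 0)" for i u v w
    define \<omega> where "\<omega> i a b c = \<Psi> i (\<pi> a) (\<pi> b) (\<pi> c)" for i a b c
    have \<phi>sym: "\<phi> i a b = \<phi> i b a" for i a b unfolding \<phi>_def by (rule cut_sym)
    have \<Psi>1: "\<Psi> i u v w = \<Psi> i v u w" for i u v w
      using \<phi>sym by (simp add: \<Psi>_def cobdry_def ac_simps)
    have \<Psi>2: "\<Psi> i u v w = \<Psi> i u w v" for i u v w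
      using \<phi>sym by (simp add: \<Psi>_def cobdry_def ac_simps)
    have \<Psi>3: "\<Psi> i u u v = 0" for i u v by (simp add: \<Psi>_def cobdry_def \<phi>_def)
    have "\<exists>\<theta>. (\<forall>a\<in>X. \<forall>b\<in>X. \<theta> a b = \<theta> b a) \<and> (\<forall>a\<in>X. \<theta> a a = 0) \<and>
      (\<forall>a\<in>X. \<forall>b\<in>X. \<forall>c\<in>X. d a b \<le> 2 * h \<longrightarrow> d b c \<le> 2 * h \<longrightarrow> d a c \<le> 2 * h \<longrightarrow>
        \<theta> a b + \<theta> b c + \<theta> a c = \<omega> i a b c)" for i
    proof (rule X.rips_cocycle_exact[OF x0 hr(1,2) fin])
      fix a b c e assume *: "{a, b, c, e} \<subseteq> X" "\<And>u v. u \<in> {a, b, c, e} \<Longrightarrow> v \<in> {a, b, c, e} \<Longrightarrow> d u v \<le> 2 * h"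
      show "\<omega> i b c e + \<omega> i a c e + \<omega> i a b e + \<omega> i a b c = 0"
        unfolding \<omega>_def
      proof (rule degenerate_cocycle)
        show "\<pi> a = \<pi> b \<or> \<pi> a = \<pi> c \<or> \<pi> a = \<pi> e \<or> \<pi> b = \<pi> c \<or> \<pi> b = \<pi> e \<or> \<pi> c = \<pi> e"
          using dim2[OF *(1)] *(2) unfolding r_def by blast
      qed (fact \<Psi>1 \<Psi>2 \<Psi>3)+
    qed (unfold \<omega>_def, (fact \<Psi>1 \<Psi>2 \<Psi>3)+)
    then obtain \<theta> where \<theta>: "\<And>i a b. a \<in> X \<Longrightarrow> b \<in> X \<Longrightarrow> \<theta> i a b = \<theta> i b a" "\<And>i a. a \<in> X \<Longrightarrow> \<theta> i a a = 0"
      "\<And>i a b c. a \<in> X \<Longrightarrow> b \<in> X \<Longrightarrow> c \<in> X \<Longrightarrow> d a b \<le> r \<Longrightarrow> d b c \<le> r \<Longrightarrow> d a c \<le> r \<Longrightarrow>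
        \<theta> i a b + \<theta> i b c + \<theta> i a c = \<omega> i a b c"
      unfolding r_def by metis
    have \<omega>wt: "wt I (\<lambda>i. \<omega> i a b c) \<le> \<kappa>"
      if abc: "a \<in> X" "b \<in> X" "c \<in> X" "d a b \<le> r" "d b c \<le> r" "d a c \<le> r" for a b c
    proof (cases "\<pi> a \<in> M \<and> \<pi> b \<in> M \<and> \<pi> c \<in> M")
      case False
      then have "(\<lambda>i. \<omega> i a b c) = (\<lambda>_. 0)" by (auto simp: \<omega>_def \<Psi>_def)
      then show ?thesis by simp
    next
      case True
      then have eq: "(\<lambda>i. \<omega> i a b c) = (\<lambda>i. cobdry (cut g f i) (\<rho> a) (\<rho> b) (\<rho> c))"
        by (simp add: \<omega>_def \<Psi>_def \<phi>_def \<rho>_def)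
      have near: "e x y \<le> L" "x \<in> Y" "y \<in> Y" if "{x, y} \<subseteq> {\<rho> a, \<rho> b, \<rho> c}" for x y
        using that True abc \<rho>near[of a b] \<rho>near[of b c] \<rho>near[of a c] \<rho>d(1)[of a] \<rho>d(1)[of b] \<rho>d(1)[of c]
          Y.d_sym[of "\<rho> a" "\<rho> b"] Y.d_sym[of "\<rho> b" "\<rho> c"] Y.d_sym[of "\<rho> a" "\<rho> c"] by auto
      show ?thesis unfolding eq \<kappa>_def
      proof (rule cobdry_cut_weight)
        show "finite I" by (simp add: I_def)
        show "g x \<le> g y + L" if "{x, y} \<subseteq> {\<rho> a, \<rho> b, \<rho> c}" for x y
          by (rule gL[OF near(2,3,1)]) (fact that)+
        show "f x \<le> f y + L" if "{x, y} \<subseteq> {\<rho> a, \<rho> b, \<rho> c}" for x y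
          by (rule fL[OF near(2,3,1)]) (fact that)+
      qed
    qed
    interpret B: bounded_cochains X d \<Delta> I \<theta> r \<kappa>
    proof unfold_locales
      show "finite I" by (simp add: I_def)
      show "2 * \<Delta> + 2 \<le> r" by (rule hr(5))
      show "\<theta> i a b = \<theta> i b a" if "a \<in> X" "b \<in> X" for a b i using \<theta>(1)[OF that] .
      show "\<theta> i a a = 0" if "a \<in> X" for a i using \<theta>(2)[OF that] .
      fix a b c assume abc: "a \<in> X" "b \<in> X" "c \<in> X" "d a b \<le> r" "d b c \<le> r" "d a c \<le> r"
      show "wt I (\<lambda>i. \<theta> i a b + \<theta> i b c + \<theta> i a c) \<le> \<kappa>" unfolding \<theta>(3)[OF abc] by (rule \<omega>wt[OF abc])
    qed
    \<comment> \<open>The loop has length at most \<open>200 * R\<close>; bisection needs a power of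
      two as bound, and one exists within a factor of two.\<close>
    have N2: "\<exists>k. 200 * R \<le> 2 ^ k \<and> (2::nat) ^ k \<le> 400 * R"
    proof -
      define k where "k = (LEAST k. 200 * R \<le> (2::nat) ^ k)"
      have "200 * R \<le> 2 ^ k" 
        unfolding k_def by (rule LeastI[of _ "200 * R"]) (rule less_imp_le[OF less_exp])
      moreover have "k \<noteq> 0"
      proof
        assume "k = 0"
        then show False using \<open>200 * R \<le> 2 ^ k\<close> R by (simp add: R0_def)
      qed
      then have "\<not> 200 * R \<le> 2 ^ (k - 1)" 
        using not_less_Least[of "k - 1" "\<lambda>k. 200 * R \<le> (2::nat) ^ k"] unfolding k_def[symmetric] by linarith
      then have "(2::nat) ^ k \<le> 400 * R" using \<open>k \<noteq> 0\<close> by (cases k) auto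
      ultimately show ?thesis by blast
    qed
    then obtain k where k: "200 * R \<le> 2 ^ k" "(2::nat) ^ k \<le> 400 * R" by blast
    have upper: "wt I (\<lambda>i. path_sum (\<theta> i) p (n + m)) \<le> \<kappa> * (4 * K + 4) * ((k + 1) * 2 ^ k)"
    proof (rule B.loop_weight[OF hr(3)])
      fix j
      show "p j \<in> X" using pY YX by blast
      have "d (p j) (p (Suc j)) \<le> K * e (p j) (p (Suc j))" using lip pY by blast
      also have "\<dots> \<le> K * 1" using p1 by (intro mult_left_mono) auto
      finally show "d (p j) (p (Suc j)) \<le> K" by simp
    qed (use n m k pclosed in auto)
    have one: "path_sum (\<theta> i) p (n + m) = 1" if i: "i \<in> I" for i
    proof -
      obtain x t where xt: "i = (x, t)" "s \<le> x" "x < s + q" "L \<le> t" "t < L + q" using i by (auto simp: I_def)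
      \<comment> \<open>All pieces of points of \<open>Y\<close> lie in \<open>M\<close>, so
        \<open>\<theta> i\<close> and \<open>\<phi>' i\<close> have the same coboundary on
        \<open>Y\<close> at scale \<open>r0\<close>, and their sum is closed.\<close>
      have "path_sum (\<lambda>a b. \<theta> i a b + \<phi>' i a b) p (n + m) = 0"
      proof (rule coarsely_simply_connectedD[OF simply_connected])
        fix a b c assume abc: "a \<in> Y" "b \<in> Y" "c \<in> Y" "d a b \<le> r0" "d b c \<le> r0" "d a c \<le> r0"
        then have "\<theta> i a b + \<theta> i b c + \<theta> i a c = \<omega> i a b c" using \<theta>(3)[of a b c i] YX hr(4) by auto
        moreover have "\<omega> i a b c = cobdry (\<phi>' i) a b c"
          using YM abc by (simp add: \<omega>_def \<Psi>_def \<phi>'_def cobdry_def \<rho>_def)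
        ultimately have "(\<theta> i a b + \<theta> i b c + \<theta> i a c) + cobdry (\<phi>' i) a b c = 0" by simp
        then show "cobdry (\<lambda>a b. \<theta> i a b + \<phi>' i a b) a b c = 0" by (simp add: cobdry_def ac_simps)
      next
        show "\<theta> i a b + \<phi>' i a b = \<theta> i b a + \<phi>' i b a" if "a \<in> Y" "b \<in> Y" for a b
          using \<theta>(1)[of a b i] \<phi>sym[of i "\<rho> a" "\<rho> b"] that YX by (auto simp: \<phi>'_def)
        show "\<theta> i a a + \<phi>' i a a = 0" if "a \<in> Y" for a
          using \<theta>(2)[of a i] that YX by (auto simp: \<phi>'_def \<phi>_def)
      qed (fact pY p1 pclosed)+
      then have "path_sum (\<theta> i) p (n + m) + path_sum (\<phi>' i) p (n + m) = 0"
        by (simp add: path_sum_def sum.distrib)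
      then have "path_sum (\<theta> i) p (n + m) = path_sum (\<phi>' i) p (n + m)" by (rule bit_add_eq_0D)
      also have "\<dots> = path_sum (\<phi>' i) \<alpha> n + path_sum (\<phi>' i) (\<lambda>j. \<eta> (m - j)) m"
      proof -
        have "path_sum (\<phi>' i) p n = path_sum (\<phi>' i) \<alpha> n" by (rule path_sum_cong) (simp add: p_def)
        then show ?thesis unfolding path_sum_add p\<eta> by simp
      qed
      also have "path_sum (\<phi>' i) \<alpha> n = 1"
      proof -
        have f0: "f (\<rho> (\<alpha> j)) \<le> t" if "j \<le> n" for j
        proof -
          have "e (\<rho> (\<alpha> j)) (\<alpha> j) \<le> L" using \<rho>Y[OF \<alpha>Y[OF that]] Y.d_sym \<alpha>Y[OF that] by simp
          then show ?thesis using f_le that xt by fastforce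
        qed
        \<comment> \<open>Along the displaced geodesic the height condition in \<open>cut\<close>
          always holds, so only the change of the indicator of \<open>g \<le> x\<close> between the
          two ends matters.\<close>
        have "path_sum (\<phi>' i) \<alpha> n = path_sum (\<lambda>a b. of_bool ((g (\<rho> a) \<le> x) \<noteq> (g (\<rho> b) \<le> x))) \<alpha> n"
          by (rule path_sum_cong) (use f0 xt in \<open>auto simp: \<phi>'_def \<phi>_def cut_def\<close>)
        also have "\<dots> = of_bool ((g (\<rho> (\<alpha> 0)) \<le> x) \<noteq> (g (\<rho> (\<alpha> n)) \<le> x))"
          by (rule path_sum_telescope)
        also have "\<dots> = 1"
        proof -
          have "g (\<rho> (\<alpha> 0)) \<le> L" using \<rho>Y[OF \<alpha>Y[of 0]] by (simp add: g_def)
          moreover have "L \<le> x" using s_mid Rq xt by linarith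
          moreover have "g (\<alpha> n) = n" using Y.geodesic_dist[OF \<alpha>, of 0 n] by (simp add: g_def)
          moreover have "g (\<alpha> n) \<le> g (\<rho> (\<alpha> n)) + L" using gL \<rho>Y[OF \<alpha>Y[of n]] \<alpha>Y[of n] by simp
          moreover have "x + L < n" using s_mid Rq xt by linarith
          ultimately show ?thesis by auto
        qed
        finally show ?thesis .
      qed
      also have "path_sum (\<phi>' i) (\<lambda>j. \<eta> (m - j)) m = 0"
        unfolding path_sum_def
      proof (rule sum.neutral, rule ballI)
        fix j
        define a where "a = \<eta> (m - j)"
        define b where "b = \<eta> (m - Suc j)"
        have aY: "a \<in> Y" "b \<in> Y" using \<eta>(3) by (auto simp: a_def b_def)
        have a1: "e a b \<le> 1" using \<eta>back by (simp add: a_def b_def)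
        have "d a b \<le> K * e a b" using lip aY by blast
        also have "\<dots> \<le> K * 1" using a1 by (intro mult_left_mono) auto
        finally have ab: "e (\<rho> a) (\<rho> b) \<le> L" using \<rho>near[of a b] aY YX YM hr(3) by auto
        note \<rho>aY = \<rho>Y[OF aY(1)] and \<rho>bY = \<rho>Y[OF aY(2)]
        have ba: "e (\<rho> b) (\<rho> a) \<le> L" using ab Y.d_sym \<rho>aY \<rho>bY by simp
        \<comment> \<open>A crossing edge would put \<open>a\<close> within
          \<open>q + 2 * t + 4 * L < 3 * q + 6 * L\<close> of \<open>\<alpha> s\<close>. As
          \<open>8 * q \<le> R\<close> and \<open>48 * L < R\<close>, twice this is less than
          \<open>R\<close>, so \<open>\<eta>\<close> would enter the forbidden ball.\<close>
        show "\<phi>' i (\<eta> (m - j)) (\<eta> (m - Suc j)) = 0"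
        proof (rule ccontr)
          assume "\<phi>' i (\<eta> (m - j)) (\<eta> (m - Suc j)) \<noteq> 0"
          then have sep: "(g (\<rho> a) \<le> x) \<noteq> (g (\<rho> b) \<le> x)" "f (\<rho> a) \<le> t \<or> f (\<rho> b) \<le> t"
            unfolding \<phi>'_def \<phi>_def cut_def xt a_def b_def by (auto split: if_splits)
          have gx: "g (\<rho> a) \<le> x + L" "x \<le> g (\<rho> a) + L"
            using sep(1) gL[OF \<rho>aY(1) \<rho>bY(1) ab] gL[OF \<rho>bY(1) \<rho>aY(1) ba] by linarith+
          have "f (\<rho> a) \<le> t + L" using sep(2) fL[OF \<rho>aY(1) \<rho>bY(1) ab] by linarith
          then obtain l where l: "l \<le> n" "e (\<rho> a) (\<alpha> l) \<le> t + L" using f_le by blast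
          have gl: "g (\<alpha> l) = l" using Y.geodesic_dist[OF \<alpha>, of 0 l] l by (simp add: g_def)
          have "g (\<rho> a) \<le> g (\<alpha> l) + (t + L)" "g (\<alpha> l) \<le> g (\<rho> a) + (t + L)"
            using gL[OF \<rho>aY(1) \<alpha>Y[OF l(1)] l(2)] gL[OF \<alpha>Y[OF l(1)] \<rho>aY(1), of "t + L"] l
              Y.d_sym[OF \<rho>aY(1) \<alpha>Y[OF l(1)]] by auto
          then have "l \<le> s + q + t + 2 * L" "s \<le> l + q + t + 2 * L" using gx gl xt by linarith+
          then have "e (\<alpha> l) (\<alpha> s) \<le> q + t + 2 * L"
            using Y.geodesic_dist[OF \<alpha>, of l s] Y.geodesic_dist'[OF \<alpha>, of s l] s l by linarith
          moreover have "e a (\<alpha> s) \<le> e a (\<rho> a) + e (\<rho> a) (\<alpha> s)" "e (\<rho> a) (\<alpha> s) \<le> e (\<rho> a) (\<alpha> l) + e (\<alpha> l) (\<alpha> s)"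
            using Y.d_tri aY \<rho>aY \<alpha>Y l s by blast+
          moreover have "R \<le> 2 * e a (\<alpha> s)" using \<eta>(4)[of "m - j"] by (simp add: a_def)
          ultimately show False using l \<rho>aY(2) xt Rq by linarith
        qed
      qed
      finally show ?thesis by simp
    qed
    have "{i \<in> I. path_sum (\<theta> i) p (n + m) = 1} = I" using one by blast
    then have "wt I (\<lambda>i. path_sum (\<theta> i) p (n + m)) = card I" by (simp add: wt_def)
    then have "q * q \<le> \<kappa> * (4 * K + 4) * ((k + 1) * 2 ^ k)"
      using upper by (simp add: I_def card_cartesian_product)
    then have "40960000 * (q * q) \<le> 40960000 * (\<kappa> * (4 * K + 4) * ((k + 1) * 2 ^ k))" by (rule mult_left_mono) simp
    also have "\<dots> = C * (k + 1) * 2 ^ k" by (simp only: C_def mult.assoc)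
    finally have qC: "40960000 * (q * q) \<le> C * (k + 1) * 2 ^ k" .
    have "(2::nat) ^ k \<le> 6400 * q" using k Rq by linarith
    then have "(2::nat) ^ k * 2 ^ k \<le> (6400 * q) * (6400 * q)" by (intro mult_mono) auto
    also have "\<dots> = 40960000 * (q * q)" by simp
    also note qC
    finally have "(2::nat) ^ k \<le> C * (k + 1)" by simp
    moreover have "k0 \<le> k"
    proof (rule ccontr)
      assume "\<not> k0 \<le> k"
      then have "(2::nat) ^ k \<le> 2 ^ k0" by (intro power_increasing) auto
      then show False using k Rq by linarith
    qed
    ultimately show False using k0[of k] by simp
  qed
  then show ?thesis by blast
qed

section \<open>Word metrics and presentations\<close>

context group begin

definition letters :: "'a set \<Rightarrow> 'a set" where
  "letters S = S \<union> (\<lambda>s. inv s) ` S"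

lemma letters_closed: "S \<subseteq> carrier G \<Longrightarrow> letters S \<subseteq> carrier G"
  by (auto simp: letters_def)

lemma inv_letters: "S \<subseteq> carrier G \<Longrightarrow> x \<in> letters S \<Longrightarrow> inv x \<in> letters S"
  by (auto simp: letters_def)

lemma list_prod_Nil [simp]: "list_prod G [] = \<one>"
  and list_prod_Cons [simp]: "list_prod G (x # xs) = x \<otimes> list_prod G xs"
  by (simp_all add: list_prod_def)

lemma list_prod_closed [simp]: "xs \<in> lists (carrier G) \<Longrightarrow> list_prod G xs \<in> carrier G"
  by (induction xs) auto

lemma list_prod_append:
  "xs \<in> lists (carrier G) \<Longrightarrow> ys \<in> lists (carrier G) \<Longrightarrow> list_prod G (xs @ ys) = list_prod G xs \<otimes> list_prod G ys"
  by (induction xs) (auto simp: m_assoc)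

lemma list_prod_rev_inv:
  "xs \<in> lists (carrier G) \<Longrightarrow> list_prod G (rev (map (\<lambda>x. inv x) xs)) = inv (list_prod G xs)"
proof (induction xs)
  case (Cons x xs)
  have "rev (map (\<lambda>x. inv x) xs) \<in> lists (carrier G)" using Cons.prems by (auto simp: in_lists_conv_set)
  then show ?case using Cons by (simp add: list_prod_append inv_mult_group)
qed simp

lemma generate_imp_word:
  assumes "S \<subseteq> carrier G" "g \<in> generate G S"
  shows "\<exists>xs\<in>lists (letters S). list_prod G xs = g"
  using assms(2)
proof (induction rule: generate.induct)
  case one then show ?case by (intro bexI[of _ "[]"]) auto
next
  case (incl h) then show ?case using assms by (intro bexI[of _ "[h]"]) (auto simp: letters_def)
next
  case (inv h) then show ?case using assms by (intro bexI[of _ "[inv h]"]) (auto simp: letters_def)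
next
  case (eng h1 h2)
  then obtain xs ys where "xs \<in> lists (letters S)" "ys \<in> lists (letters S)" "list_prod G xs = h1" "list_prod G ys = h2"
    by blast
  moreover have "lists (letters S) \<subseteq> lists (carrier G)" using letters_closed[OF assms(1)] by (rule lists_mono)
  ultimately show ?case by (intro bexI[of _ "xs @ ys"]) (auto simp: list_prod_append subsetD)
qed

lemma word_length_le: "xs \<in> lists (letters S) \<Longrightarrow> word_length G S (list_prod G xs) \<le> length xs"
  unfolding word_length_def letters_def by (rule Least_le) blast

lemma word_length_witness:
  assumes "fin_gen_set G S" "g \<in> carrier G"
  obtains xs where "xs \<in> lists (letters S)" "length xs = word_length G S g" "list_prod G xs = g"
proof -
  have "\<exists>n xs. xs \<in> lists (letters S) \<and> length xs = n \<and> list_prod G xs = g"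
    using generate_imp_word[of S g] assms by (auto simp: fin_gen_set_def)
  from LeastI_ex[OF this] show ?thesis using that unfolding word_length_def letters_def by blast
qed

lemma word_length_one [simp]: "word_length G S \<one> = 0"
  using word_length_le[of "[]" S] by simp

lemma word_length_mult:
  assumes S: "fin_gen_set G S" and "g \<in> carrier G" "h \<in> carrier G"
  shows "word_length G S (g \<otimes> h) \<le> word_length G S g + word_length G S h"
proof -
  have sub: "lists (letters S) \<subseteq> lists (carrier G)"
    using letters_closed S unfolding fin_gen_set_def by (intro lists_mono) blast
  obtain xs where xs: "xs \<in> lists (letters S)" "length xs = word_length G S g" "list_prod G xs = g"
    using word_length_witness assms by blast
  obtain ys where ys: "ys \<in> lists (letters S)" "length ys = word_length G S h" "list_prod G ys = h"
    using word_length_witness assms by blast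
  have "list_prod G (xs @ ys) = g \<otimes> h" using list_prod_append xs ys sub by blast
  then show ?thesis using word_length_le[of "xs @ ys" S] xs ys by auto
qed

lemma word_length_inv_le:
  assumes S: "fin_gen_set G S" and "g \<in> carrier G"
  shows "word_length G S (inv g) \<le> word_length G S g"
proof -
  have SG: "S \<subseteq> carrier G" using S by (simp add: fin_gen_set_def)
  then have sub: "lists (letters S) \<subseteq> lists (carrier G)" using letters_closed by (intro lists_mono) blast
  obtain xs where xs: "xs \<in> lists (letters S)" "length xs = word_length G S g" "list_prod G xs = g"
    using word_length_witness assms by blast
  have "rev (map (\<lambda>x. inv x) xs) \<in> lists (letters S)"
    using xs(1) inv_letters[OF SG] by (auto simp: in_lists_conv_set)
  moreover have "list_prod G (rev (map (\<lambda>x. inv x) xs)) = inv g" using list_prod_rev_inv xs sub by blast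
  ultimately show ?thesis using word_length_le[of "rev (map (\<lambda>x. inv x) xs)" S] xs by simp
qed

lemma word_length_inv:
  assumes "fin_gen_set G S" "g \<in> carrier G"
  shows "word_length G S (inv g) = word_length G S g"
  using word_length_inv_le[OF assms] word_length_inv_le[OF assms(1), of "inv g"] assms(2) by simp

lemma word_length_list_prod:
  assumes S: "fin_gen_set G S" and T: "T \<subseteq> carrier G" "\<And>x. x \<in> T \<Longrightarrow> word_length G S x \<le> C"
    and xs: "xs \<in> lists T"
  shows "word_length G S (list_prod G xs) \<le> C * length xs"
  using xs
proof (induction xs rule: list.induct)
  case (Cons x xs)
  have "xs \<in> lists T" using Cons.prems by simp
  then have "xs \<in> lists (carrier G)" using lists_mono[OF T(1)] by blast
  then have "word_length G S (list_prod G (x # xs)) \<le> word_length G S x + word_length G S (list_prod G xs)"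
    using word_length_mult[OF S, of x "list_prod G xs"] Cons.prems T(1) by auto
  moreover have "word_length G S x \<le> C" using T(2) Cons.prems by simp
  moreover have "word_length G S (list_prod G xs) \<le> C * length xs" using Cons by simp
  ultimately show ?case by simp
qed simp

text \<open>Needed because hyperbolicity and asymptotic dimension each come with a generating set of
  their own.\<close>

lemma word_length_comparison:
  assumes S: "fin_gen_set G S" and T: "fin_gen_set G T"
  shows "\<exists>C. \<forall>g\<in>carrier G. word_length G S g \<le> C * word_length G T g"
proof -
  \<comment> \<open>Adding 0 keeps the maximum meaningful for an empty generating set.\<close>
  define C where "C = Max (word_length G S ` letters T \<union> {0})"
  have fin: "finite (letters T)" using T by (simp add: letters_def fin_gen_set_def)
  have "word_length G S g \<le> C * word_length G T g" if g: "g \<in> carrier G" for g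
  proof -
    obtain xs where xs: "xs \<in> lists (letters T)" "length xs = word_length G T g" "list_prod G xs = g"
      using word_length_witness[OF T g] .
    have "word_length G S (list_prod G xs) \<le> C * length xs"
    proof (rule word_length_list_prod[OF S _ _ xs(1)])
      show "letters T \<subseteq> carrier G" using letters_closed T by (simp add: fin_gen_set_def)
      show "word_length G S x \<le> C" if "x \<in> letters T" for x
        unfolding C_def using fin that by (intro Max_ge) auto
    qed
    then show ?thesis using xs by simp
  qed
  then show ?thesis by blast
qed

lemma finite_word_ball:
  assumes S: "fin_gen_set G S"
  shows "finite {g \<in> carrier G. word_length G S g \<le> N}"
proof (rule finite_subset)
  show "{g \<in> carrier G. word_length G S g \<le> N} \<subseteq> list_prod G ` {xs. set xs \<subseteq> letters S \<and> length xs \<le> N}"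
  proof
    fix g assume g: "g \<in> {g \<in> carrier G. word_length G S g \<le> N}"
    then obtain xs where "xs \<in> lists (letters S)" "length xs = word_length G S g" "list_prod G xs = g"
      using word_length_witness[OF S, of g] by auto
    then show "g \<in> list_prod G ` {xs. set xs \<subseteq> letters S \<and> length xs \<le> N}"
      using g by (intro image_eqI[of _ _ xs]) auto
  qed
  show "finite (list_prod G ` {xs. set xs \<subseteq> letters S \<and> length xs \<le> N})"
    using S by (intro finite_imageI finite_lists_length_le) (simp add: letters_def fin_gen_set_def)
qed

definition cayley_dist :: "'a set \<Rightarrow> 'a \<Rightarrow> 'a \<Rightarrow> nat" where
  "cayley_dist S x y = word_length G S (inv x \<otimes> y)"

lemma word_dist_eq: "word_dist G S = (\<lambda>x y. real (cayley_dist S x y))"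
  by (simp add: fun_eq_iff word_dist_def cayley_dist_def)

lemma inv_mult_cancel_left: "x \<in> carrier G \<Longrightarrow> y \<in> carrier G \<Longrightarrow> x \<otimes> (inv x \<otimes> y) = y"
  by (simp flip: m_assoc)

lemma inv_mult_chain:
  "x \<in> carrier G \<Longrightarrow> y \<in> carrier G \<Longrightarrow> z \<in> carrier G \<Longrightarrow> (inv x \<otimes> y) \<otimes> (inv y \<otimes> z) = inv x \<otimes> z"
  by (simp add: m_assoc inv_mult_cancel_left)

lemma graph_metric_cayley:
  assumes S: "fin_gen_set G S"
  shows "graph_metric (carrier G) (cayley_dist S)"
proof
  fix x assume "x \<in> carrier G"
  then show "cayley_dist S x x = 0" by (simp add: cayley_dist_def)
next
  fix x y assume xy: "x \<in> carrier G" "y \<in> carrier G"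
  obtain xs where xs: "xs \<in> lists (letters S)" "length xs = cayley_dist S x y" "list_prod G xs = inv x \<otimes> y"
    using word_length_witness[OF S, of "inv x \<otimes> y"] xy by (auto simp: cayley_dist_def)
  have y: "y = x \<otimes> list_prod G xs" using xs xy by (simp add: inv_mult_cancel_left)
  show "x = y" if "cayley_dist S x y = 0"
  proof -
    have "xs = []" using that xs(2) by simp
    then show ?thesis using y xy by simp
  qed
  have "inv (inv x \<otimes> y) = inv y \<otimes> x" using xy by (simp add: inv_mult_group)
  then show "cayley_dist S x y = cayley_dist S y x"
    using word_length_inv[OF S, of "inv x \<otimes> y"] xy by (simp add: cayley_dist_def)
  show "cayley_dist S x z \<le> cayley_dist S x y + cayley_dist S y z" if "z \<in> carrier G" for z
    using word_length_mult[OF S, of "inv x \<otimes> y" "inv y \<otimes> z"] inv_mult_chain that xy by (simp add: cayley_dist_def)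
  assume "x \<noteq> y"
  \<comment> \<open>The neighbour demanded by \<open>d_step\<close> is reached by the first letter
    of a shortest word for the difference of \<open>x\<close> and \<open>y\<close>.\<close>
  then obtain a ys where ays: "xs = a # ys" using y xy by (cases xs) auto
  have sub: "letters S \<subseteq> carrier G" using letters_closed S by (simp add: fin_gen_set_def)
  have a: "a \<in> letters S" "ys \<in> lists (letters S)" "a \<in> carrier G" "ys \<in> lists (carrier G)"
    using xs(1) ays sub lists_mono[OF sub] by auto
  have 1: "inv x \<otimes> (x \<otimes> a) = list_prod G [a]" using a xy by (simp flip: m_assoc)
  have 2: "inv (x \<otimes> a) \<otimes> y = list_prod G ys"
    using a xy ays y by (simp add: inv_mult_group m_assoc flip: m_assoc[of a "list_prod G ys"]) (simp flip: m_assoc)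
  have "cayley_dist S x (x \<otimes> a) \<le> 1"
    unfolding cayley_dist_def 1 using word_length_le[of "[a]" S] a by simp
  moreover have "cayley_dist S (x \<otimes> a) y < cayley_dist S x y"
    unfolding cayley_dist_def[of S "x \<otimes> a"] 2 using word_length_le[of ys S] a ays xs(2) by simp
  ultimately show "\<exists>z\<in>carrier G. cayley_dist S x z \<le> 1 \<and> cayley_dist S z y < cayley_dist S x y"
    using a xy by (intro bexI[of _ "x \<otimes> a"]) auto
qed

text \<open>Written out and doubled, the Gromov product inequality becomes the four-point condition
  with error \<open>2 * \<delta>\<close>, rounded up to a natural number.\<close>

lemma hyperbolic_graph_cayley:
  assumes S: "fin_gen_set G S" and hyp: "gromov_hyperbolic_on (carrier G) (word_dist G S)"
  shows "\<exists>\<Delta>. hyperbolic_graph (carrier G) (cayley_dist S) \<Delta>"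
proof -
  obtain \<delta> where \<delta>: "\<delta> \<ge> 0" "\<And>x y z w. x \<in> carrier G \<Longrightarrow> y \<in> carrier G \<Longrightarrow> z \<in> carrier G \<Longrightarrow> w \<in> carrier G \<Longrightarrow>
      gromov_product (word_dist G S) w x z \<ge> min (gromov_product (word_dist G S) w x y) (gromov_product (word_dist G S) w y z) - \<delta>"
    using hyp unfolding gromov_hyperbolic_on_def by blast
  define \<Delta> where "\<Delta> = nat \<lceil>2 * \<delta>\<rceil>"
  have \<Delta>: "2 * \<delta> \<le> real \<Delta>" unfolding \<Delta>_def by linarith
  interpret graph_metric "carrier G" "cayley_dist S" by (rule graph_metric_cayley[OF S])
  have "hyperbolic_graph (carrier G) (cayley_dist S) \<Delta>"
  proof
    fix x y z w assume X: "x \<in> carrier G" "y \<in> carrier G" "z \<in> carrier G" "w \<in> carrier G"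
    have "real (cayley_dist S x z + cayley_dist S y w) \<le>
      real (max (cayley_dist S x y + cayley_dist S z w) (cayley_dist S y z + cayley_dist S x w) + \<Delta>)"
      using \<delta>(2)[OF X] \<Delta> unfolding gromov_product_def word_dist_eq
      by (auto simp: min_def max_def field_simps split: if_splits)
    then show "cayley_dist S x z + cayley_dist S y w \<le>
      max (cayley_dist S x y + cayley_dist S z w) (cayley_dist S y z + cayley_dist S x w) + \<Delta>"
      by (simp only: of_nat_le_iff)
  qed
  then show ?thesis by blast
qed

text \<open>A point is sent to its colour together with a piece of that colour containing it. Two of
  four points share one of the three colours; being close, they must lie in the same piece, since
  distinct pieces of one colour are far apart.\<close>

lemma asdim_two_colouring:
  assumes S: "fin_gen_set G S" and dim: "asdim_group_le G 2"
  shows "\<exists>(\<pi> :: 'a \<Rightarrow> nat \<times> 'a set) D.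
    (\<forall>a\<in>carrier G. \<forall>b\<in>carrier G. \<pi> a = \<pi> b \<longrightarrow> cayley_dist S a b \<le> D) \<and>
    (\<forall>a b c e. {a, b, c, e} \<subseteq> carrier G \<longrightarrow> (\<forall>u\<in>{a, b, c, e}. \<forall>v\<in>{a, b, c, e}. cayley_dist S u v \<le> r) \<longrightarrow>
      \<pi> a = \<pi> b \<or> \<pi> a = \<pi> c \<or> \<pi> a = \<pi> e \<or> \<pi> b = \<pi> c \<or> \<pi> b = \<pi> e \<or> \<pi> c = \<pi> e)"
proof -
  obtain T where T: "fin_gen_set G T" "asdim_le_on (carrier G) (word_dist G T) 2"
    using dim unfolding asdim_group_le_def by blast
  obtain C where "\<forall>g\<in>carrier G. word_length G S g \<le> C * word_length G T g" using word_length_comparison[OF S T(1)] by blast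
  then have C: "cayley_dist S x y \<le> C * cayley_dist T x y" if "x \<in> carrier G" "y \<in> carrier G" for x y
    using that by (simp add: cayley_dist_def)
  obtain C' where "\<forall>g\<in>carrier G. word_length G T g \<le> C' * word_length G S g" using word_length_comparison[OF T(1) S] by blast
  then have C': "cayley_dist T x y \<le> C' * cayley_dist S x y" if "x \<in> carrier G" "y \<in> carrier G" for x y
    using that by (simp add: cayley_dist_def)
  \<comment> \<open>The scale \<open>r\<close> translated to the generating set \<open>T\<close>;
    the added 1 keeps it positive even if the product is zero.\<close>
  have "real (C' * r + 1) > 0" by (subst of_nat_0_less_iff) simp
  from T(2)[unfolded asdim_le_on_def, rule_format, OF this]
  obtain U :: "nat \<Rightarrow> 'a set set" and D where U: "(\<Union>i\<le>2. \<Union>(U i)) = carrier G"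
    "\<forall>i\<le>2. \<forall>A\<in>U i. \<forall>x\<in>A. \<forall>y\<in>A. word_dist G T x y \<le> D"
    "\<forall>i\<le>2. \<forall>A\<in>U i. \<forall>B\<in>U i. A \<noteq> B \<longrightarrow> (\<forall>x\<in>A. \<forall>y\<in>B. word_dist G T x y > real (C' * r + 1))"
    by (elim exE conjE) (rule that)
  have "\<forall>a\<in>carrier G. \<exists>u. fst u \<le> 2 \<and> snd u \<in> U (fst u) \<and> a \<in> snd u"
  proof
    fix a assume "a \<in> carrier G"
    then have "a \<in> (\<Union>i\<le>2. \<Union>(U i))" using U(1) by simp
    then obtain i A where "i \<le> 2" "A \<in> U i" "a \<in> A" by auto
    then show "\<exists>u. fst u \<le> 2 \<and> snd u \<in> U (fst u) \<and> a \<in> snd u" by (intro exI[of _ "(i, A)"]) simp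
  qed
  then obtain \<pi> where \<pi>: "\<And>a. a \<in> carrier G \<Longrightarrow> fst (\<pi> a) \<le> 2 \<and> snd (\<pi> a) \<in> U (fst (\<pi> a)) \<and> a \<in> snd (\<pi> a)"
    by metis
  have same: "\<pi> a = \<pi> b" if ab: "a \<in> carrier G" "b \<in> carrier G" "cayley_dist S a b \<le> r" "fst (\<pi> a) = fst (\<pi> b)" for a b
  proof (rule ccontr)
    assume "\<pi> a \<noteq> \<pi> b"
    then have "snd (\<pi> a) \<noteq> snd (\<pi> b)" using ab(4) prod_eqI by blast
    then have "word_dist G T a b > real (C' * r + 1)" using U(3) \<pi>[OF ab(1)] \<pi>[OF ab(2)] ab(4) by metis
    moreover have "cayley_dist T a b \<le> C' * r" using C'[OF ab(1,2)] ab(3) by (meson mult_le_mono2 order_trans)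
    ultimately show False unfolding word_dist_eq of_nat_less_iff by linarith
  qed
  have "cayley_dist S a b \<le> C * nat \<lceil>D\<rceil>" if ab: "a \<in> carrier G" "b \<in> carrier G" "\<pi> a = \<pi> b" for a b
  proof -
    have "word_dist G T a b \<le> D" using U(2) \<pi>[OF ab(1)] \<pi>[OF ab(2)] ab(3) by metis
    then have "cayley_dist T a b \<le> nat \<lceil>D\<rceil>" unfolding word_dist_eq by linarith
    then show ?thesis using C[OF ab(1,2)] by (meson mult_le_mono2 order_trans)
  qed
  moreover have "\<pi> a = \<pi> b \<or> \<pi> a = \<pi> c \<or> \<pi> a = \<pi> e \<or> \<pi> b = \<pi> c \<or> \<pi> b = \<pi> e \<or> \<pi> c = \<pi> e"
    if X: "{a, b, c, e} \<subseteq> carrier G" and near: "\<forall>u\<in>{a, b, c, e}. \<forall>v\<in>{a, b, c, e}. cayley_dist S u v \<le> r" for a b c e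
  proof -
    have "fst (\<pi> a) \<le> 2" "fst (\<pi> b) \<le> 2" "fst (\<pi> c) \<le> 2" "fst (\<pi> e) \<le> 2" using \<pi> X by auto
    then have "fst (\<pi> a) = fst (\<pi> b) \<or> fst (\<pi> a) = fst (\<pi> c) \<or> fst (\<pi> a) = fst (\<pi> e) \<or>
      fst (\<pi> b) = fst (\<pi> c) \<or> fst (\<pi> b) = fst (\<pi> e) \<or> fst (\<pi> c) = fst (\<pi> e)" by linarith
    then show ?thesis
      using same[of a b] same[of a c] same[of a e] same[of b c] same[of b e] same[of c e] X near by auto
  qed
  ultimately show ?thesis by blast
qed

section \<open>Words read as paths in the Cayley graph\<close>

definition letter_eval :: "(nat \<Rightarrow> 'a) \<Rightarrow> nat \<times> bool \<Rightarrow> 'a" where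
  "letter_eval f l = (if snd l then inv (f (fst l)) else f (fst l))"

lemma word_eval_eq: "word_eval G f w = list_prod G (map (letter_eval f) w)"
  unfolding word_eval_def by (rule arg_cong[where f = "list_prod G"]) (auto simp: letter_eval_def)

text \<open>The sum of \<open>\<chi>\<close> along the path that starts at \<open>g\<close> and is
  labelled by the word.\<close>

primrec word_sum :: "(nat \<Rightarrow> 'a) \<Rightarrow> ('a \<Rightarrow> 'a \<Rightarrow> bit) \<Rightarrow> 'a \<Rightarrow> word \<Rightarrow> bit" where
  "word_sum f \<chi> g [] = 0"
| "word_sum f \<chi> g (l # w) = \<chi> g (g \<otimes> letter_eval f l) + word_sum f \<chi> (g \<otimes> letter_eval f l) w"

context
  fixes f :: "nat \<Rightarrow> 'a"
  assumes f: "\<And>i. f i \<in> carrier G"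
begin

lemma letter_eval_closed [simp]: "letter_eval f l \<in> carrier G"
  using f by (simp add: letter_eval_def)

lemma map_letter_eval_lists [simp]: "map (letter_eval f) w \<in> lists (carrier G)"
  by auto

lemma word_eval_Nil [simp]: "word_eval G f [] = \<one>"
  and word_eval_Cons [simp]: "word_eval G f (l # w) = letter_eval f l \<otimes> word_eval G f w"
  and word_eval_closed [simp]: "word_eval G f w \<in> carrier G"
  by (simp_all add: word_eval_eq)

lemma word_eval_append [simp]: "word_eval G f (u @ v) = word_eval G f u \<otimes> word_eval G f v"
  by (simp add: word_eval_eq list_prod_append)

lemma word_sum_append:
  "g \<in> carrier G \<Longrightarrow> word_sum f \<chi> g (u @ v) = word_sum f \<chi> g u + word_sum f \<chi> (g \<otimes> word_eval G f u) v"
  by (induction u arbitrary: g) (simp_all add: ac_simps m_assoc)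

text \<open>A cancelling pair traverses an edge back and forth, and a relator is a loop that can be
  coned off. Equality of values is proved simultaneously so that the rest of the word starts at the
  same vertex on both sides.\<close>

lemma word_sum_pres_eq:
  assumes \<chi>_sym: "\<And>a b. a \<in> carrier G \<Longrightarrow> b \<in> carrier G \<Longrightarrow> \<chi> a b = \<chi> b a"
    and \<chi>_deg: "\<And>a. a \<in> carrier G \<Longrightarrow> \<chi> a a = 0"
    and closed: "\<And>a b c. a \<in> carrier G \<Longrightarrow> b \<in> carrier G \<Longrightarrow> c \<in> carrier G \<Longrightarrow>
      near a b \<Longrightarrow> near b c \<Longrightarrow> near a c \<Longrightarrow> cobdry \<chi> a b c = 0"
    and rel: "\<And>r. r \<in> R \<Longrightarrow> word_eval G f r = \<one>"
    and near: "\<And>g r k l. g \<in> carrier G \<Longrightarrow> r \<in> R \<Longrightarrow> near (g \<otimes> word_eval G f (take k r)) (g \<otimes> word_eval G f (take l r))"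
    and "pres_eq R u v"
  shows "word_eval G f u = word_eval G f v \<and> (\<forall>g\<in>carrier G. word_sum f \<chi> g u = word_sum f \<chi> g v)"
  using assms(6)
proof (induction rule: pres_eq.induct)
  case (pe_cancel u i b v)
  have inv: "letter_eval f (i, b) \<otimes> letter_eval f (i, \<not> b) = \<one>" using f by (simp add: letter_eval_def)
  have "letter_eval f (i, b) \<otimes> (letter_eval f (i, \<not> b) \<otimes> x) = x" if "x \<in> carrier G" for x
    using inv that by (simp flip: m_assoc)
  moreover have "g \<otimes> letter_eval f (i, b) \<otimes> letter_eval f (i, \<not> b) = g" if "g \<in> carrier G" for g
    using inv that by (simp add: m_assoc)
  ultimately show ?case using \<chi>_sym by (auto simp: word_sum_append)
next
  case (pe_rel r u v)
  \<comment> \<open>The cone over the relator with apex \<open>g\<close>: each prefix is replaced by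
    its chord, one triangle at a time.\<close>
  have "word_sum f \<chi> g (take k r) = \<chi> g (g \<otimes> word_eval G f (take k r))" if g: "g \<in> carrier G" for g k
  proof (induction k)
    case (Suc k)
    show ?case
    proof (cases "k < length r")
      case True
      define a where "a = g \<otimes> word_eval G f (take k r)"
      define b where "b = g \<otimes> word_eval G f (take (Suc k) r)"
      have b: "b = a \<otimes> letter_eval f (r ! k)" using g True by (simp add: a_def b_def take_Suc_conv_app_nth m_assoc)
      have X: "a \<in> carrier G" "b \<in> carrier G" using g by (simp_all add: a_def b_def)
      have "near g a" "near a b" "near g b"
        using near[OF g pe_rel, of 0 k] near[OF g pe_rel, of k "Suc k"] near[OF g pe_rel, of 0 "Suc k"] g
        by (simp_all add: a_def b_def)
      then have "\<chi> g a + \<chi> a b + \<chi> g b = 0" using closed[of g a b] g X by (simp add: cobdry_def)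
      then have "\<chi> g a + \<chi> a b = \<chi> g b" by (rule bit_add_eq_0D)
      moreover have "word_sum f \<chi> g (take (Suc k) r) = \<chi> g a + \<chi> a b"
        using Suc g True b by (simp add: take_Suc_conv_app_nth word_sum_append a_def)
      ultimately show ?thesis by (simp add: b_def)
    qed (use Suc in simp)
  qed (use \<chi>_deg g in simp)
  from this[of _ "length r"] have "word_sum f \<chi> g r = 0" if "g \<in> carrier G" for g
    using rel[OF pe_rel] \<chi>_deg that by simp
  then show ?case using rel[OF pe_rel] by (simp add: word_sum_append)
qed auto

text \<open>A step of the path is either stationary, contributing 0 by \<open>\<chi>_deg\<close>, or
  spells one letter.\<close>

lemma path_to_word:
  assumes S: "fin_gen_set G (f ` {..<n})" and \<chi>_deg: "\<And>a. a \<in> carrier G \<Longrightarrow> \<chi> a a = 0"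
    and p: "\<And>j. p j \<in> carrier G" "\<And>j. cayley_dist (f ` {..<n}) (p j) (p (Suc j)) \<le> 1"
  shows "\<exists>w\<in>lists ({..<n} \<times> UNIV). p 0 \<otimes> word_eval G f w = p m \<and> word_sum f \<chi> (p 0) w = path_sum \<chi> p m"
proof (induction m)
  case 0
  show ?case using p by (intro bexI[of _ "[]"]) auto
next
  case (Suc m)
  then obtain w where w: "w \<in> lists ({..<n} \<times> UNIV)" "p 0 \<otimes> word_eval G f w = p m"
    "word_sum f \<chi> (p 0) w = path_sum \<chi> p m" by blast
  obtain xs where xs: "xs \<in> lists (letters (f ` {..<n}))" "length xs = cayley_dist (f ` {..<n}) (p m) (p (Suc m))"
    "list_prod G xs = inv (p m) \<otimes> p (Suc m)"
    using word_length_witness[OF S, of "inv (p m) \<otimes> p (Suc m)"] p by (auto simp: cayley_dist_def)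
  have pm: "p m \<otimes> list_prod G xs = p (Suc m)" using xs p by (simp add: inv_mult_cancel_left)
  consider "xs = []" | x where "xs = [x]" using xs(2) p(2)[of m] by (cases xs; cases "tl xs") auto
  then show ?case
  proof cases
    case 1
    then have "p (Suc m) = p m" using pm p by simp
    then show ?thesis using w \<chi>_deg p by (intro bexI[of _ w]) (auto simp: path_sum_Suc)
  next
    case 2
    then obtain i b where ib: "i < n" "x = letter_eval f (i, b)" using xs(1)
      by (force simp: letters_def letter_eval_def)
    have "p (Suc m) = p m \<otimes> letter_eval f (i, b)" using pm 2 ib by simp
    then show ?thesis using w p ib
      by (intro bexI[of _ "w @ [(i, b)]"]) (auto simp: path_sum_Suc word_sum_append simp flip: m_assoc)
  qed
qed

end

text \<open>A loop spells a word with trivial value, which the presentation reduces to the empty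
  word without changing the sum of a closed cochain. Relators have length at most \<open>N\<close>,
  so any two vertices of a relator loop are at distance at most \<open>2 * N\<close> through its
  base point.\<close>

lemma finitely_presented_simply_connected:
  assumes fp: "finitely_presented G"
  shows "\<exists>S N. fin_gen_set G S \<and>
    coarsely_simply_connected (carrier G) (cayley_dist S) (\<lambda>a b. cayley_dist S a b \<le> N)"
proof -
  obtain n :: nat and f0 :: "nat \<Rightarrow> 'a" and R :: "word set" where
    f0: "f0 ` {..<n} \<subseteq> carrier G" "generate G (f0 ` {..<n}) = carrier G" and
    R: "finite R" "R \<subseteq> lists ({..<n} \<times> UNIV)"
    and pres: "\<forall>w\<in>lists ({..<n} \<times> UNIV). word_eval G f0 w = \<one> \<longleftrightarrow> pres_eq R w []"
    using fp unfolding finitely_presented_def by blast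
  \<comment> \<open>A derivation of \<open>pres_eq\<close> may pass through letters \<open>i \<ge> n\<close>, where \<open>f0\<close> is junk.\<close>
  define f where "f i = (if i < n then f0 i else \<one>)" for i
  have f: "f i \<in> carrier G" for i using f0 by (auto simp: f_def)
  have im: "f ` {..<n} = f0 ` {..<n}" by (simp add: f_def)
  have S: "fin_gen_set G (f ` {..<n})" using f0 unfolding im by (simp add: fin_gen_set_def)
  have eval: "word_eval G f w = word_eval G f0 w" if "w \<in> lists ({..<n} \<times> UNIV)" for w
    unfolding word_eval_eq using that
    by (intro arg_cong[where f = "list_prod G"]) (auto simp: letter_eval_def f_def)
  have rel: "word_eval G f r = \<one>" if "r \<in> R" for r
  proof -
    have "r \<in> lists ({..<n} \<times> UNIV)" using R(2) that by blast
    then show ?thesis using bspec[OF pres] eval pres_eq.pe_rel[OF that, of "[]" "[]"] by simp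
  qed
  obtain N where N: "\<And>w. w \<in> R \<Longrightarrow> length w \<le> N"
    using R(1) by (metis finite_imageI finite_nat_set_iff_bounded_le image_eqI)
  have len: "word_length G (f ` {..<n}) (word_eval G f w) \<le> length w" if "w \<in> lists ({..<n} \<times> UNIV)" for w
  proof -
    have "map (letter_eval f) w \<in> lists (letters (f ` {..<n}))"
      using that by (auto simp: in_lists_conv_set letter_eval_def letters_def)
    then show ?thesis using word_length_le[of "map (letter_eval f) w"] by (simp add: word_eval_eq)
  qed
  interpret M: graph_metric "carrier G" "cayley_dist (f ` {..<n})" by (rule graph_metric_cayley[OF S])
  have pre: "cayley_dist (f ` {..<n}) g (g \<otimes> word_eval G f (take k r)) \<le> N" if "g \<in> carrier G" "r \<in> R" for g k r
  proof -
    have "take k r \<in> lists ({..<n} \<times> UNIV)" using that(2) R(2) by (auto simp: in_lists_conv_set dest: in_set_takeD)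
    then have "word_length G (f ` {..<n}) (word_eval G f (take k r)) \<le> length (take k r)" by (rule len)
    moreover have "length (take k r) \<le> N" using N[OF that(2)] by simp
    moreover have "inv g \<otimes> (g \<otimes> word_eval G f (take k r)) = word_eval G f (take k r)"
      using that(1) word_eval_closed[OF f] by (simp flip: m_assoc)
    ultimately show ?thesis unfolding cayley_dist_def by (metis order_trans)
  qed
  show ?thesis
  proof (intro exI[of _ "f ` {..<n}"] exI[of _ "2 * N"] conjI S coarsely_simply_connectedI)
    fix \<chi> p m
    assume \<chi>: "\<And>a b. a \<in> carrier G \<Longrightarrow> b \<in> carrier G \<Longrightarrow> \<chi> a b = \<chi> b a" "\<And>a. a \<in> carrier G \<Longrightarrow> \<chi> a a = 0"
      and cl: "\<And>a b c. a \<in> carrier G \<Longrightarrow> b \<in> carrier G \<Longrightarrow> c \<in> carrier G \<Longrightarrow> cayley_dist (f ` {..<n}) a b \<le> 2 * N \<Longrightarrow>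
        cayley_dist (f ` {..<n}) b c \<le> 2 * N \<Longrightarrow> cayley_dist (f ` {..<n}) a c \<le> 2 * N \<Longrightarrow> cobdry \<chi> a b c = 0"
      and p: "\<And>j. p j \<in> carrier G" "\<And>j. cayley_dist (f ` {..<n}) (p j) (p (Suc j)) \<le> 1" "p m = p 0"
    obtain w where w: "w \<in> lists ({..<n} \<times> UNIV)" "p 0 \<otimes> word_eval G f w = p 0" "word_sum f \<chi> (p 0) w = path_sum \<chi> p m"
      using path_to_word[where \<chi> = \<chi> and p = p and m = m, OF f S] \<chi>(2) p by auto
    have "word_eval G f w = \<one>" using w(2) p(1) word_eval_closed[OF f] by (simp add: l_cancel_one)
    then have "pres_eq R w []" using pres eval w(1) by auto
    have "word_sum f \<chi> (p 0) w = word_sum f \<chi> (p 0) []"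
    proof -
      have "cayley_dist (f ` {..<n}) (g \<otimes> word_eval G f (take k r)) (g \<otimes> word_eval G f (take l r)) \<le> 2 * N" if g: "g \<in> carrier G" "r \<in> R" for g r k l
      proof -
        define a where "a = g \<otimes> word_eval G f (take k r)"
        define b where "b = g \<otimes> word_eval G f (take l r)"
        have X: "a \<in> carrier G" "b \<in> carrier G" using g word_eval_closed[OF f] by (simp_all add: a_def b_def)
        have "cayley_dist (f ` {..<n}) a b \<le> cayley_dist (f ` {..<n}) a g + cayley_dist (f ` {..<n}) g b"
          using M.d_tri X g by blast
        moreover have "cayley_dist (f ` {..<n}) a g = cayley_dist (f ` {..<n}) g a" using M.d_sym X g by blast
        ultimately show ?thesis using pre[OF g, of k] pre[OF g, of l] by (simp add: a_def b_def)
      qed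
      then have "word_eval G f w = word_eval G f [] \<and> (\<forall>g\<in>carrier G. word_sum f \<chi> g w = word_sum f \<chi> g [])"
        by (intro word_sum_pres_eq[where near = "\<lambda>a b. cayley_dist (f ` {..<n}) a b \<le> 2 * N" and \<chi> = \<chi>, OF f \<chi> cl rel _ \<open>pres_eq R w []\<close>])
      then show ?thesis using p(1) by blast
    qed
    then show "path_sum \<chi> p m = 0" using w(3) by simp
  qed
qed

end

theorem theorem1p6:
  fixes G :: "('a, 'b) monoid_scheme" and H :: "'a set"
  assumes "group G"
    and "hyperbolic_group G"
    and "asdim_group_le G 2"
    and "subgroup H G"
    and "finitely_presented (G\<lparr>carrier := H\<rparr>)"
  shows "hyperbolic_group (G\<lparr>carrier := H\<rparr>)"
proof -
  interpret G: group G by (rule assms(1))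
  define K where "K = G\<lparr>carrier := H\<rparr>"
  interpret K: group K unfolding K_def by (rule subgroup.subgroup_is_group[OF assms(4,1)])
  have carrier_K [simp]: "carrier K = H" and [simp]: "mult K = mult G" "one K = one G" by (simp_all add: K_def)
  have HG: "H \<subseteq> carrier G" using assms(4) by (rule subgroup.subset)
  have Kinv: "inv\<^bsub>K\<^esub> x = inv\<^bsub>G\<^esub> x" if "x \<in> H" for x
    unfolding K_def using G.m_inv_consistent[OF assms(4) that] .
  have Klp: "list_prod K xs = list_prod G xs" for xs by (simp add: list_prod_def)
  obtain S where S: "fin_gen_set G S" "gromov_hyperbolic_on (carrier G) (word_dist G S)"
    using assms(2) unfolding hyperbolic_group_def by blast
  \<comment> \<open>Hyperbolicity will be shown for the generating set of the presentation.\<close>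
  obtain T N where T: "fin_gen_set K T"
    and sc: "coarsely_simply_connected H (K.cayley_dist T) (\<lambda>a b. K.cayley_dist T a b \<le> N)"
    using K.finitely_presented_simply_connected assms(5) unfolding K_def[symmetric] carrier_K by blast
  obtain \<Delta> where \<Delta>: "hyperbolic_graph (carrier G) (G.cayley_dist S) \<Delta>"
    using G.hyperbolic_graph_cayley[OF S] by blast
  have Y: "graph_metric H (K.cayley_dist T)" using K.graph_metric_cayley[OF T] by simp
  \<comment> \<open>The inclusion is Lipschitz: \<open>C\<close> bounds the length in
    \<open>G\<close> of the generators of the subgroup and their inverses.\<close>
  define C where "C = Max (word_length G S ` K.letters T \<union> {0})"
  have TH: "K.letters T \<subseteq> H" using K.letters_closed T by (auto simp: fin_gen_set_def)
  have finT: "finite (K.letters T)" using T by (simp add: K.letters_def fin_gen_set_def)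
  have lip: "G.cayley_dist S a b \<le> C * K.cayley_dist T a b" if ab: "a \<in> H" "b \<in> H" for a b
  proof -
    have "inv\<^bsub>K\<^esub> a \<otimes>\<^bsub>K\<^esub> b \<in> carrier K" using ab by (intro K.m_closed K.inv_closed) simp_all
    then obtain xs where xs: "xs \<in> lists (K.letters T)" "length xs = K.cayley_dist T a b"
      "list_prod K xs = inv\<^bsub>K\<^esub> a \<otimes>\<^bsub>K\<^esub> b"
      using K.word_length_witness[OF T] unfolding K.cayley_dist_def by metis
    have "word_length G S (list_prod G xs) \<le> C * length xs"
    proof (rule G.word_length_list_prod[OF S(1) _ _ xs(1)])
      show "K.letters T \<subseteq> carrier G" using TH HG by blast
      show "word_length G S x \<le> C" if "x \<in> K.letters T" for x
        unfolding C_def using finT that by (intro Max_ge) auto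
    qed
    then show ?thesis using xs Klp Kinv[OF ab(1)] by (simp add: G.cayley_dist_def)
  qed
  have proper: "\<exists>L. \<forall>a\<in>H. \<forall>b\<in>H. G.cayley_dist S a b \<le> M \<longrightarrow> K.cayley_dist T a b \<le> L" for M
  proof -
    \<comment> \<open>The ball in \<open>G\<close> is finite, so word length in the subgroup has a
      maximum over it. On elements outside \<open>H\<close> that length is an arbitrary value, which
      can only enlarge the bound.\<close>
    define B where "B = {g \<in> carrier G. word_length G S g \<le> M}"
    have "finite B" unfolding B_def by (rule G.finite_word_ball[OF S(1)])
    have "K.cayley_dist T a b \<le> Max (word_length K T ` B)"
      if ab: "a \<in> H" "b \<in> H" "G.cayley_dist S a b \<le> M" for a b
    proof -
      have "inv\<^bsub>G\<^esub> a \<otimes>\<^bsub>G\<^esub> b \<in> B" using ab HG by (auto simp: B_def G.cayley_dist_def)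
      then show ?thesis unfolding K.cayley_dist_def using \<open>finite B\<close> Kinv[OF ab(1)] by (intro Max_ge) auto
    qed
    then show ?thesis by blast
  qed
  have "\<exists>R0. graph_metric.no_fat_loops H (K.cayley_dist T) R0"
  proof (rule no_fat_loops_of_filling[OF \<Delta> Y HG G.one_closed _ lip proper G.asdim_two_colouring[OF S(1) assms(3)]])
    fix M
    have "{x \<in> carrier G. G.cayley_dist S \<one>\<^bsub>G\<^esub> x \<le> M} = {g \<in> carrier G. word_length G S g \<le> M}"
      by (auto simp: G.cayley_dist_def)
    then show "finite {x \<in> carrier G. G.cayley_dist S \<one>\<^bsub>G\<^esub> x \<le> M}" using G.finite_word_ball[OF S(1)] by simp
  next
    \<comment> \<open>Simple connectivity is known at scale \<open>N\<close> in the subgroup metric;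
      by \<open>lip\<close> this is contained in scale \<open>C * N\<close> in
      \<open>G\<close>.\<close>
    show "coarsely_simply_connected H (K.cayley_dist T) (\<lambda>a b. G.cayley_dist S a b \<le> C * N)"
    proof (rule coarsely_simply_connected_mono[OF sc])
      show "G.cayley_dist S a b \<le> C * N" if "a \<in> H" "b \<in> H" "K.cayley_dist T a b \<le> N" for a b
        by (rule order_trans[OF lip[OF that(1,2)] mult_le_mono2[OF that(3)]])
    qed
  qed
  then obtain R0 where "graph_metric.no_fat_loops H (K.cayley_dist T) R0" by blast
  then have "gromov_hyperbolic_on H (\<lambda>x y. real (K.cayley_dist T x y))"
    by (rule graph_metric.no_fat_loops_imp_hyperbolic[OF Y])
  then have "gromov_hyperbolic_on (carrier K) (word_dist K T)" unfolding K.word_dist_eq by simp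
  then show ?thesis unfolding hyperbolic_group_def K_def[symmetric] using T K.group_axioms by blast
qed

end
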